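(* Let $(H_1,H_2)$ be an irreducible dual pair in $\mathrm{Sp}(W)$. - If this pair is of type II, then $\widetilde H_{1,S}$ and $\widetilde H_{2,S}$ are split. - If it is of type I, there exists a decomposition $W=W_1\otimes W_2$ such that $(H_1,H_2)=(U(W_1),U(W_2))$. If $W_2$ is split, then $\widetilde H_{1,S}$ is split.
   Context: $F$ is a non-archimedean local field of residual characteristic $p$ and characteristic different from $2$; $(W,\langle\,,\rangle)$ is a finite-dimensional symplectic space over $F$; $R$ is a field of characteristic $\ell\neq2$ with a fixed non-trivial smooth character $\psi:F\to R^\times$ (so $\ell\neq p$). $H=W\times F$ is the Heisenberg group, $(w,t)(w',t')=(w+w',t+t'+\tfrac12\langle w,w'\rangle)$; $(\rho_\psi,S)$ is a model of its unique (up to isomorphism) irreducible smooth $R$-representation with central character $\psi$; $\widetilde{\mathrm{Sp}}_{\psi,S}^R(W)=\{(g,M)\in\mathrm{Sp}(W)\times\mathrm{GL}_R(S):M\rho_\psi(w,t)M^{-1}=\rho_\psi(g^{-1}w,t)\ \forall(w,t)\in H\}$ with projection $p_S$ to $\mathrm{Sp}(W)$, a central extension by $R^\times$. For a subgroup $H'$ of $\mathrm{Sp}(W)$, $\widetilde{H'}_S=p_S^{-1}(H')$; it is called split if there is a group morphism $H'\to\widetilde{H'}_S$ which is a section of $p_S$. A (reductive) dual pair in $\mathrm{Sp}(W)$ is a pair of reductive subgroups which are mutual centralizers; irreducible means not coming from a non-trivial orthogonal decomposition of $W$ stable under both groups. Irreducible pairs are of type I or type II. Type II: $W=(X_1\otimes_DX_2)\oplus(X_1\otimes_DX_2)^*$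 with $D$ a division algebra over $F$ and $(H_1,H_2)=(\mathrm{GL}_D(X_1),\mathrm{GL}_D(X_2))$. Type I: $W=W_1\otimes_DW_2$ for $D$ a division algebra over $F$ with involution, $W_1$ an $\varepsilon_1$-hermitian and $W_2$ an $\varepsilon_2$-hermitian space over $D$ with $\varepsilon_2=-\varepsilon_1$, the symplectic form of $W$ being obtained from the product of the two hermitian forms by a trace $D\to F$, and $H_i=U(W_i)$ the isometry groups. An $\varepsilon$-hermitian space of dimension $n$ is split if it has a totally isotropic subspace of dimension $m$ with $n=2m$. *)

theory Defs
  imports "HOL-Analysis.Analysis" "HOL-Algebra.Group" "HOL-Library.Poly_Mapping"
begin

section \<open>Non-archimedean local fields and their finite-dimensional vector spaces\<close>

definition abs_topology :: "('f::field \<Rightarrow> real) \<Rightarrow> 'f topology" where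
  "abs_topology absF = Metric_space.mtopology UNIV (\<lambda>x y. absF (x - y))"

text \<open>
  A non-archimedean local field is presented as a non-trivially valued ultrametric field whose
  topology is locally compact; completeness, discreteness of the valuation and finiteness of the
  residue field \<open>{x. absF x \<le> 1} / {x. absF x < 1}\<close> are consequences. The last two
  assumptions say that the residue field has characteristic \<open>p\<close>.
\<close>

locale nonarch_local_field =
  fixes absF :: "'f::field \<Rightarrow> real" and p :: nat
  assumes abs_nonneg: "0 \<le> absF x"
    and abs_eq_0_iff: "absF x = 0 \<longleftrightarrow> x = 0"
    and abs_mult: "absF (x * y) = absF x * absF y"
    and abs_ultrametric: "absF (x + y) \<le> max (absF x) (absF y)"
    and abs_nontrivial: "\<exists>x. x \<noteq> 0 \<and> absF x \<noteq> 1"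
    and locally_compact: "locally_compact_space (abs_topology absF)"
    and prime_p: "prime p"
    and residue_char: "absF (of_nat p) < 1"

text \<open>
  The canonical topology of a finite-dimensional \<open>F\<close>-vector space, in a form that involves
  no choice of a basis: taking for \<open>B\<close> a basis, the condition says that a coordinate box
  around \<open>w\<close> is contained in \<open>U\<close>, and the conditions for the other finite
  sets \<open>B\<close> follow from that one.
\<close>

definition vs_topology ::
    "('f::field \<Rightarrow> real) \<Rightarrow> ('f \<Rightarrow> 'w::ab_group_add \<Rightarrow> 'w) \<Rightarrow> 'w topology" where
  "vs_topology absF smul = topology (\<lambda>U. \<forall>w\<in>U. \<forall>B. finite B \<longrightarrow>
     (\<exists>\<epsilon>>0. \<forall>c. (\<forall>b\<in>B. absF (c b) < \<epsilon>) \<longrightarrow> w + (\<Sum>b\<in>B. smul (c b) b) \<in> U))"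

lemma openin_vs_topology:
  fixes smul :: "'f::field \<Rightarrow> 'w::ab_group_add \<Rightarrow> 'w"
  shows "openin (vs_topology absF smul) U \<longleftrightarrow> (\<forall>w\<in>U. \<forall>B. finite B \<longrightarrow>
     (\<exists>\<epsilon>>0. \<forall>c. (\<forall>b\<in>B. absF (c b) < \<epsilon>) \<longrightarrow> w + (\<Sum>b\<in>B. smul (c b) b) \<in> U))"
proof -
  let ?P = "\<lambda>U. \<forall>w\<in>U. \<forall>B. finite B \<longrightarrow>
     (\<exists>\<epsilon>>0. \<forall>c. (\<forall>b\<in>B. absF (c b) < \<epsilon>) \<longrightarrow> w + (\<Sum>b\<in>B. smul (c b) b) \<in> U)"
  have int: "?P (S \<inter> T)" if S: "?P S" and T: "?P T" for S T
  proof (intro ballI allI impI)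
    fix w B assume w: "w \<in> S \<inter> T" and B: "finite (B :: 'w set)"
    obtain d where d: "d > 0" "\<And>c. \<forall>b\<in>B. absF (c b) < d \<Longrightarrow> w + (\<Sum>b\<in>B. smul (c b) b) \<in> S"
      using S w B by (meson IntD1)
    obtain e where e: "e > 0" "\<And>c. \<forall>b\<in>B. absF (c b) < e \<Longrightarrow> w + (\<Sum>b\<in>B. smul (c b) b) \<in> T"
      using T w B by (meson IntD2)
    show "\<exists>\<epsilon>>0. \<forall>c. (\<forall>b\<in>B. absF (c b) < \<epsilon>) \<longrightarrow> w + (\<Sum>b\<in>B. smul (c b) b) \<in> S \<inter> T"
      using d e by (intro exI[of _ "min d e"]) auto
  qed
  have un: "?P (\<Union>K)" if K: "\<forall>S\<in>K. ?P S" for K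
  proof (intro ballI allI impI)
    fix w B assume w: "w \<in> \<Union>K" and B: "finite (B :: 'w set)"
    then obtain S where S: "S \<in> K" "w \<in> S" by blast
    then obtain e where "e > 0" "\<And>c. \<forall>b\<in>B. absF (c b) < e \<Longrightarrow> w + (\<Sum>b\<in>B. smul (c b) b) \<in> S"
      using K B by meson
    then show "\<exists>\<epsilon>>0. \<forall>c. (\<forall>b\<in>B. absF (c b) < \<epsilon>) \<longrightarrow> w + (\<Sum>b\<in>B. smul (c b) b) \<in> \<Union>K"
      using S(1) by (metis UnionI)
  qed
  have "istopology ?P"
    unfolding istopology_def by (intro conjI allI impI int un)
  then show ?thesis
    by (simp add: vs_topology_def topology_inverse')
qed


section \<open>Symplectic spaces and the symplectic group\<close>

locale symplectic_space = vector_space smul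
  for smul :: "'f::field \<Rightarrow> 'w::ab_group_add \<Rightarrow> 'w" +
  fixes form :: "'w \<Rightarrow> 'w \<Rightarrow> 'f"
  assumes finite_dimensional: "\<exists>Basis. finite_dimensional_vector_space smul Basis"
    and form_linear_left: "Vector_Spaces.linear smul (*) (\<lambda>w. form w w')"
    and form_linear_right: "Vector_Spaces.linear smul (*) (form w)"
    and form_alternating: "form w w = 0"
    and form_nondegenerate: "(\<forall>w'. form w w' = 0) \<Longrightarrow> w = 0"

text \<open>
  The product of \<open>g\<close> and \<open>h\<close> is ``first \<open>g\<close>, then \<open>h\<close>'' (\<open>Sp(W)\<close> multiplies
  as if it acted on the right of \<open>W\<close>). This is the order for which the relation
  \<open>M \<rho>(w,t) M\<inverse> = \<rho>(g\<inverse>w,t)\<close> defines a subgroup of \<open>Sp(W) \<times> GL(S)\<close>: from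
  \<open>M M' \<rho>(w,t) (M M')\<inverse> = \<rho>(g\<inverse>(g'\<inverse>w),t)\<close> one reads off that \<open>M M'\<close> lies over the map
  \<open>w \<mapsto> g'(g w)\<close>. Subgroups and centralizers do not depend on this choice.
\<close>

definition Sp :: "('f::field \<Rightarrow> 'w::ab_group_add \<Rightarrow> 'w) \<Rightarrow> ('w \<Rightarrow> 'w \<Rightarrow> 'f) \<Rightarrow> ('w \<Rightarrow> 'w) monoid" where
  "Sp smul form =
     \<lparr>carrier = {g. Vector_Spaces.linear smul smul g \<and> bij g \<and> (\<forall>w w'. form (g w) (g w') = form w w')},
      monoid.mult = (\<lambda>g h. h \<circ> g), one = id\<rparr>"

definition GL :: "('r::field \<Rightarrow> 's::ab_group_add \<Rightarrow> 's) \<Rightarrow> ('s \<Rightarrow> 's) monoid" where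
  "GL smulS =
     \<lparr>carrier = {M. Vector_Spaces.linear smulS smulS M \<and> bij M}, monoid.mult = (\<circ>), one = id\<rparr>"


section \<open>The Heisenberg group, its representation and the metaplectic group\<close>

definition heisenberg :: "('w::ab_group_add \<Rightarrow> 'w \<Rightarrow> 'f::field) \<Rightarrow> ('w \<times> 'f) monoid" where
  "heisenberg form =
     \<lparr>carrier = UNIV,
      monoid.mult = (\<lambda>(w, t) (w', t'). (w + w', t + t' + form w w' / 2)), one = (0, 0)\<rparr>"

definition smooth_character :: "('f::field \<Rightarrow> real) \<Rightarrow> ('f \<Rightarrow> 'r::field) \<Rightarrow> bool" where
  "smooth_character absF \<psi> \<longleftrightarrow>
     \<psi> 0 = 1 \<and> (\<forall>x y. \<psi> (x + y) = \<psi> x * \<psi> y) \<and> openin (abs_topology absF) {x. \<psi> x = 1}"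

locale heisenberg_rep = vector_space smulS
  for smulS :: "'r::field \<Rightarrow> 's::ab_group_add \<Rightarrow> 's" +
  fixes absF :: "'f::field \<Rightarrow> real" and smul :: "'f \<Rightarrow> 'w::ab_group_add \<Rightarrow> 'w"
    and form :: "'w \<Rightarrow> 'w \<Rightarrow> 'f" and \<psi> :: "'f \<Rightarrow> 'r" and \<rho> :: "'w \<times> 'f \<Rightarrow> 's \<Rightarrow> 's"
  assumes hom: "\<rho> \<in> hom (heisenberg form) (GL smulS)"
    and smooth: "openin (prod_topology (vs_topology absF smul) (abs_topology absF)) {h. \<rho> h v = v}"
    and central_character: "\<rho> (0, t) v = smulS (\<psi> t) v"
    and nonzero: "\<exists>v::'s. v \<noteq> 0"
    and irreducible: "\<lbrakk>subspace V; \<forall>h. \<rho> h ` V \<subseteq> V\<rbrakk> \<Longrightarrow> V = {0} \<or> V = UNIV"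

definition Mp :: "('f::field \<Rightarrow> 'w::ab_group_add \<Rightarrow> 'w) \<Rightarrow> ('w \<Rightarrow> 'w \<Rightarrow> 'f) \<Rightarrow>
    ('r::field \<Rightarrow> 's::ab_group_add \<Rightarrow> 's) \<Rightarrow> ('w \<times> 'f \<Rightarrow> 's \<Rightarrow> 's) \<Rightarrow> (('w \<Rightarrow> 'w) \<times> ('s \<Rightarrow> 's)) monoid" where
  "Mp smul form smulS \<rho> = (Sp smul form \<times>\<times> GL smulS)
     \<lparr>carrier := {(g, M). g \<in> carrier (Sp smul form) \<and> M \<in> carrier (GL smulS) \<and>
        (\<forall>w t. M \<circ> \<rho> (w, t) \<circ> inv_into UNIV M = \<rho> (inv_into UNIV g w, t))}\<rparr>"

definition Mp_preimage where
  "Mp_preimage smul form smulS \<rho> H =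
     (Mp smul form smulS \<rho>)\<lparr>carrier := {x \<in> carrier (Mp smul form smulS \<rho>). fst x \<in> H}\<rparr>"

definition Mp_split :: "('f::field \<Rightarrow> 'w::ab_group_add \<Rightarrow> 'w) \<Rightarrow> ('w \<Rightarrow> 'w \<Rightarrow> 'f) \<Rightarrow>
    ('r::field \<Rightarrow> 's::ab_group_add \<Rightarrow> 's) \<Rightarrow> ('w \<times> 'f \<Rightarrow> 's \<Rightarrow> 's) \<Rightarrow> ('w \<Rightarrow> 'w) set \<Rightarrow> bool" where
  "Mp_split smul form smulS \<rho> H \<longleftrightarrow>
     (\<exists>\<sigma> \<in> hom ((Sp smul form)\<lparr>carrier := H\<rparr>) (Mp_preimage smul form smulS \<rho> H).
        \<forall>g\<in>H. fst (\<sigma> g) = g)"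


section \<open>Dual pairs\<close>

text \<open>
  As usual in the theory of dual pairs (Howe; Moeglin, Vigneras and Waldspurger), a subgroup \<open>H\<close> of \<open>Sp(W)\<close> is
  called reductive if \<open>W\<close> is a semisimple \<open>H\<close>-module.
\<close>

definition reductive_subgroup ::
    "('f::field \<Rightarrow> 'w::ab_group_add \<Rightarrow> 'w) \<Rightarrow> ('w \<Rightarrow> 'w \<Rightarrow> 'f) \<Rightarrow> ('w \<Rightarrow> 'w) set \<Rightarrow> bool" where
  "reductive_subgroup smul form H \<longleftrightarrow> subgroup H (Sp smul form) \<and>
     (\<forall>U. module.subspace smul U \<and> (\<forall>h\<in>H. h ` U \<subseteq> U) \<longrightarrow>
       (\<exists>V. module.subspace smul V \<and> (\<forall>h\<in>H. h ` V \<subseteq> V) \<and>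
            U \<inter> V = {0} \<and> {u + v |u v. u \<in> U \<and> v \<in> V} = UNIV))"

definition centralizer_in :: "('a, 'b) monoid_scheme \<Rightarrow> 'a set \<Rightarrow> 'a set" where
  "centralizer_in G H = {g \<in> carrier G. \<forall>h\<in>H. g \<otimes>\<^bsub>G\<^esub> h = h \<otimes>\<^bsub>G\<^esub> g}"

definition dual_pair where
  "dual_pair smul form H1 H2 \<longleftrightarrow>
     reductive_subgroup smul form H1 \<and> reductive_subgroup smul form H2 \<and>
     H1 = centralizer_in (Sp smul form) H2 \<and> H2 = centralizer_in (Sp smul form) H1"

definition irreducible_dual_pair where
  "irreducible_dual_pair smul form H1 H2 \<longleftrightarrow> dual_pair smul form H1 H2 \<and>
     \<not> (\<exists>U V. module.subspace smul U \<and> module.subspace smul V \<and> U \<noteq> {0} \<and> V \<noteq> {0} \<and>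
          U \<inter> V = {0} \<and> {u + v |u v. u \<in> U \<and> v \<in> V} = UNIV \<and>
          (\<forall>u\<in>U. \<forall>v\<in>V. form u v = 0) \<and>
          (\<forall>h \<in> H1 \<union> H2. h ` U \<subseteq> U \<and> h ` V \<subseteq> V))"


section \<open>Modules over division algebras and tensor products\<close>

locale division_algebra = vector_space smulD
  for smulD :: "'f::field \<Rightarrow> 'd::division_ring \<Rightarrow> 'd" +
  assumes smulD_mult_left: "smulD a (x * y) = smulD a x * y"
    and smulD_mult_right: "smulD a (x * y) = x * smulD a y"
    and finite_dimensional: "\<exists>Basis. finite_dimensional_vector_space smulD Basis"

definition D_span :: "('d::division_ring \<Rightarrow> 'x::ab_group_add \<Rightarrow> 'x) \<Rightarrow> 'x set \<Rightarrow> 'x set" where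
  "D_span act B = {\<Sum>b\<in>B. act (c b) b |c. True}"

definition D_subspace :: "('d::division_ring \<Rightarrow> 'x::ab_group_add \<Rightarrow> 'x) \<Rightarrow> 'x set \<Rightarrow> bool" where
  "D_subspace act V \<longleftrightarrow> 0 \<in> V \<and> (\<forall>x\<in>V. \<forall>y\<in>V. x + y \<in> V) \<and> (\<forall>d. \<forall>x\<in>V. act d x \<in> V)"

definition has_D_dim :: "('d::division_ring \<Rightarrow> 'x::ab_group_add \<Rightarrow> 'x) \<Rightarrow> 'x set \<Rightarrow> nat \<Rightarrow> bool" where
  "has_D_dim act V n \<longleftrightarrow> (\<exists>B. finite B \<and> card B = n \<and> D_span act B = V \<and>
     (\<forall>c. (\<Sum>b\<in>B. act (c b) b) = 0 \<longrightarrow> (\<forall>b\<in>B. c b = 0)))"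

locale left_D_space =
  fixes lact :: "'d::division_ring \<Rightarrow> 'x::ab_group_add \<Rightarrow> 'x"
  assumes lact_add_left: "lact (d + e) x = lact d x + lact e x"
    and lact_add_right: "lact d (x + y) = lact d x + lact d y"
    and lact_lact: "lact d (lact e x) = lact (d * e) x"
    and lact_one: "lact 1 x = x"
    and finite_dimensional: "\<exists>B. finite B \<and> D_span lact B = UNIV"

locale right_D_space =
  fixes ract :: "'x::ab_group_add \<Rightarrow> 'd::division_ring \<Rightarrow> 'x"
  assumes ract_add_right: "ract x (d + e) = ract x d + ract x e"
    and ract_add_left: "ract (x + y) d = ract x d + ract y d"
    and ract_ract: "ract (ract x d) e = ract x (d * e)"
    and ract_one: "ract x 1 = x"
    and finite_dimensional: "\<exists>B. finite B \<and> D_span (\<lambda>d x. ract x d) B = UNIV"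

text \<open>
  \<open>X1 \<otimes>\<^bsub>D\<^esub> X2\<close> is the free abelian group on \<open>X1 \<times> X2\<close> modulo the subgroup
  generated by the following relations.
\<close>

inductive_set tensor_relations ::
    "('x1::ab_group_add \<Rightarrow> 'd::division_ring \<Rightarrow> 'x1) \<Rightarrow> ('d \<Rightarrow> 'x2::ab_group_add \<Rightarrow> 'x2) \<Rightarrow>
      (('x1 \<times> 'x2) \<Rightarrow>\<^sub>0 int) set"
  for ract lact where
  zero: "0 \<in> tensor_relations ract lact"
| add_left: "Poly_Mapping.single (x + x', y) 1 - Poly_Mapping.single (x, y) 1
      - Poly_Mapping.single (x', y) 1 \<in> tensor_relations ract lact"
| add_right: "Poly_Mapping.single (x, y + y') 1 - Poly_Mapping.single (x, y) 1
      - Poly_Mapping.single (x, y') 1 \<in> tensor_relations ract lact"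
| balanced: "Poly_Mapping.single (ract x d, y) 1 - Poly_Mapping.single (x, lact d y) 1
      \<in> tensor_relations ract lact"
| diff: "\<lbrakk>u \<in> tensor_relations ract lact; v \<in> tensor_relations ract lact\<rbrakk>
      \<Longrightarrow> u - v \<in> tensor_relations ract lact"

text \<open>
  The subset \<open>X\<close> of the \<open>F\<close>-vector space \<open>W\<close> is the tensor product
  \<open>X1 \<otimes>\<^bsub>D\<^esub> X2\<close>, with \<open>tens x y\<close> in the role of \<open>x \<otimes> y\<close>: the additive extension
  of \<open>tens\<close> to the free abelian group on \<open>X1 \<times> X2\<close> has image \<open>X\<close> and kernel the
  subgroup of relations, and \<open>F\<close> acts by \<open>a (x \<otimes> y) = (x a) \<otimes> y\<close>.
\<close>

definition is_tensor_product ::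
    "('f::field \<Rightarrow> 'w::ab_group_add \<Rightarrow> 'w) \<Rightarrow> ('f \<Rightarrow> 'd::division_ring \<Rightarrow> 'd) \<Rightarrow>
      ('x1::ab_group_add \<Rightarrow> 'd \<Rightarrow> 'x1) \<Rightarrow> ('d \<Rightarrow> 'x2::ab_group_add \<Rightarrow> 'x2) \<Rightarrow>
      ('x1 \<Rightarrow> 'x2 \<Rightarrow> 'w) \<Rightarrow> 'w set \<Rightarrow> bool" where
  "is_tensor_product smul smulD ract lact tens X \<longleftrightarrow>
     (let ext = (\<lambda>u :: ('x1 \<times> 'x2) \<Rightarrow>\<^sub>0 int. \<Sum>(x, y) \<in> Poly_Mapping.keys u.
            smul (of_int (Poly_Mapping.lookup u (x, y))) (tens x y))
      in range ext = X \<and> {u. ext u = 0} = tensor_relations ract lact) \<and>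
     (\<forall>a x y. smul a (tens x y) = tens (ract x (smulD a 1)) y)"

definition left_GL :: "('d::division_ring \<Rightarrow> 'x::ab_group_add \<Rightarrow> 'x) \<Rightarrow> ('x \<Rightarrow> 'x) set" where
  "left_GL lact = {g. bij g \<and> (\<forall>x y. g (x + y) = g x + g y) \<and> (\<forall>d x. g (lact d x) = lact d (g x))}"

definition right_GL :: "('x::ab_group_add \<Rightarrow> 'd::division_ring \<Rightarrow> 'x) \<Rightarrow> ('x \<Rightarrow> 'x) set" where
  "right_GL ract = {g. bij g \<and> (\<forall>x y. g (x + y) = g x + g y) \<and> (\<forall>x d. g (ract x d) = ract (g x) d)}"


section \<open>Dual pairs of type II\<close>

text \<open>
  \<open>W = X \<oplus> X\<^sup>*\<close> with \<open>X = X1 \<otimes>\<^bsub>D\<^esub> X2\<close>; the summand \<open>X\<^sup>*\<close> is the subspace \<open>Y\<close>,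
  whose elements are linear functionals on \<open>X\<close> through the symplectic form. An element of
  \<open>GL\<^bsub>D\<^esub>(Xi)\<close> acts on \<open>X\<close> through its factor and on \<open>Y\<close> contragrediently; the latter is the
  preservation of the symplectic form.
\<close>

locale type_II_decomposition =
  symplectic_space smul form + D: division_algebra smulD +
  X1: right_D_space ract + X2: left_D_space lact
  for smul :: "'f::field \<Rightarrow> 'w::ab_group_add \<Rightarrow> 'w" and form :: "'w \<Rightarrow> 'w \<Rightarrow> 'f"
    and smulD :: "'f \<Rightarrow> 'd::division_ring \<Rightarrow> 'd"
    and ract :: "'x1::ab_group_add \<Rightarrow> 'd \<Rightarrow> 'x1" and lact :: "'d \<Rightarrow> 'x2::ab_group_add \<Rightarrow> 'x2" +
  fixes tens :: "'x1 \<Rightarrow> 'x2 \<Rightarrow> 'w" and X Y :: "'w set"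
  assumes subspace_X: "module.subspace smul X" and subspace_Y: "module.subspace smul Y"
    and direct_sum: "X \<inter> Y = {0}" "{x + y |x y. x \<in> X \<and> y \<in> Y} = UNIV"
    and isotropic_X: "\<lbrakk>x \<in> X; x' \<in> X\<rbrakk> \<Longrightarrow> form x x' = 0"
    and isotropic_Y: "\<lbrakk>y \<in> Y; y' \<in> Y\<rbrakk> \<Longrightarrow> form y y' = 0"
    and Y_dual_of_X: "Vector_Spaces.linear smul (*) l \<Longrightarrow> \<exists>!y. y \<in> Y \<and> (\<forall>x\<in>X. form x y = l x)"
    and tensor: "is_tensor_product smul smulD ract lact tens X"

definition type_II_GL1 where
  "type_II_GL1 smul form ract tens X Y = {h \<in> carrier (Sp smul form). h ` X \<subseteq> X \<and> h ` Y \<subseteq> Y \<and>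
     (\<exists>g \<in> right_GL ract. \<forall>x1 x2. h (tens x1 x2) = tens (g x1) x2)}"

definition type_II_GL2 where
  "type_II_GL2 smul form lact tens X Y = {h \<in> carrier (Sp smul form). h ` X \<subseteq> X \<and> h ` Y \<subseteq> Y \<and>
     (\<exists>g \<in> left_GL lact. \<forall>x1 x2. h (tens x1 x2) = tens x1 (g x2))}"

text \<open>
  The type argument names the types of \<open>D\<close>, \<open>X1\<close> and \<open>X2\<close>.
\<close>

definition type_II_pair ::
    "('d::division_ring \<times> 'x1::ab_group_add \<times> 'x2::ab_group_add) itself \<Rightarrow>
      ('f::field \<Rightarrow> 'w::ab_group_add \<Rightarrow> 'w) \<Rightarrow> ('w \<Rightarrow> 'w \<Rightarrow> 'f) \<Rightarrow>
      ('w \<Rightarrow> 'w) set \<Rightarrow> ('w \<Rightarrow> 'w) set \<Rightarrow> bool" where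
  "type_II_pair _ smul form H1 H2 \<longleftrightarrow>
     (\<exists>(smulD :: 'f \<Rightarrow> 'd \<Rightarrow> 'd) (ract :: 'x1 \<Rightarrow> 'd \<Rightarrow> 'x1) (lact :: 'd \<Rightarrow> 'x2 \<Rightarrow> 'x2) tens X Y.
        type_II_decomposition smul form smulD ract lact tens X Y \<and>
        H1 = type_II_GL1 smul form ract tens X Y \<and> H2 = type_II_GL2 smul form lact tens X Y)"


section \<open>Hermitian spaces and dual pairs of type I\<close>

locale division_algebra_involution = division_algebra smulD
  for smulD :: "'f::field \<Rightarrow> 'd::division_ring \<Rightarrow> 'd" +
  fixes star :: "'d \<Rightarrow> 'd"
  assumes star_linear: "Vector_Spaces.linear smulD smulD star"
    and star_mult: "star (x * y) = star y * star x"
    and star_star: "star (star x) = x"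

locale right_hermitian_space = right_D_space ract
  for ract :: "'x::ab_group_add \<Rightarrow> 'd::division_ring \<Rightarrow> 'x" +
  fixes star :: "'d \<Rightarrow> 'd" and eps :: 'd and h :: "'x \<Rightarrow> 'x \<Rightarrow> 'd"
  assumes sign: "eps = 1 \<or> eps = -1"
    and add_left: "h (x + x') y = h x y + h x' y"
    and add_right: "h x (y + y') = h x y + h x y'"
    and sesquilinear: "h (ract x d) (ract y e) = star d * h x y * e"
    and hermitian: "h y x = eps * star (h x y)"
    and nondegenerate: "(\<forall>y. h x y = 0) \<Longrightarrow> x = 0"

locale left_hermitian_space = left_D_space lact
  for lact :: "'d::division_ring \<Rightarrow> 'x::ab_group_add \<Rightarrow> 'x" +
  fixes star :: "'d \<Rightarrow> 'd" and eps :: 'd and h :: "'x \<Rightarrow> 'x \<Rightarrow> 'd"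
  assumes sign: "eps = 1 \<or> eps = -1"
    and add_left: "h (x + x') y = h x y + h x' y"
    and add_right: "h x (y + y') = h x y + h x y'"
    and sesquilinear: "h (lact d x) (lact e y) = d * h x y * star e"
    and hermitian: "h y x = eps * star (h x y)"
    and nondegenerate: "(\<forall>y. h x y = 0) \<Longrightarrow> x = 0"

definition split_hermitian ::
    "('d::division_ring \<Rightarrow> 'x::ab_group_add \<Rightarrow> 'x) \<Rightarrow> ('x \<Rightarrow> 'x \<Rightarrow> 'd) \<Rightarrow> bool" where
  "split_hermitian act h \<longleftrightarrow> (\<exists>n m V. has_D_dim act UNIV n \<and> D_subspace act V \<and> has_D_dim act V m \<and>
     (\<forall>x\<in>V. \<forall>y\<in>V. h x y = 0) \<and> n = 2 * m)"

text \<open>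
  A trace \<open>D \<rightarrow> F\<close> is a non-zero \<open>F\<close>-linear form vanishing on commutators and invariant under
  the involution, such as the reduced trace composed with the trace of the centre over \<open>F\<close> (when
  the centre is separable over \<open>F\<close>). The conjugate of \<open>h2\<close> in the formula for the symplectic form
  makes the product balanced when \<open>W1\<close> is a right and \<open>W2\<close> a left space.
\<close>

locale type_I_decomposition =
  symplectic_space smul form + D: division_algebra_involution smulD star +
  W1: right_hermitian_space ract star eps1 h1 + W2: left_hermitian_space lact star eps2 h2
  for smul :: "'f::field \<Rightarrow> 'w::ab_group_add \<Rightarrow> 'w" and form :: "'w \<Rightarrow> 'w \<Rightarrow> 'f"
    and smulD :: "'f \<Rightarrow> 'd::division_ring \<Rightarrow> 'd" and star :: "'d \<Rightarrow> 'd"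
    and ract :: "'w1::ab_group_add \<Rightarrow> 'd \<Rightarrow> 'w1" and eps1 :: 'd and h1 :: "'w1 \<Rightarrow> 'w1 \<Rightarrow> 'd"
    and lact :: "'d \<Rightarrow> 'w2::ab_group_add \<Rightarrow> 'w2" and eps2 :: 'd and h2 :: "'w2 \<Rightarrow> 'w2 \<Rightarrow> 'd" +
  fixes tr :: "'d \<Rightarrow> 'f" and tens :: "'w1 \<Rightarrow> 'w2 \<Rightarrow> 'w"
  assumes opposite_signs: "eps2 = - eps1"
    and tr_linear: "Vector_Spaces.linear smulD (*) tr"
    and tr_nonzero: "\<exists>d. tr d \<noteq> 0"
    and tr_commute: "tr (d * e) = tr (e * d)"
    and tr_star: "tr (star d) = tr d"
    and tensor: "is_tensor_product smul smulD ract lact tens UNIV"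
    and form_tens: "form (tens x y) (tens x' y') = tr (h1 x x' * star (h2 y y'))"

definition type_I_U1 where
  "type_I_U1 smul form ract h1 tens = {h \<in> carrier (Sp smul form).
     \<exists>g \<in> right_GL ract. (\<forall>x x'. h1 (g x) (g x') = h1 x x') \<and> (\<forall>x y. h (tens x y) = tens (g x) y)}"

definition type_I_U2 where
  "type_I_U2 smul form lact h2 tens = {h \<in> carrier (Sp smul form).
     \<exists>g \<in> left_GL lact. (\<forall>y y'. h2 (g y) (g y') = h2 y y') \<and> (\<forall>x y. h (tens x y) = tens x (g y))}"

definition realizes_type_I where
  "realizes_type_I smul form H1 H2 smulD star ract eps1 h1 lact eps2 h2 tr tens \<longleftrightarrow>
     type_I_decomposition smul form smulD star ract eps1 h1 lact eps2 h2 tr tens \<and>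
     H1 = type_I_U1 smul form ract h1 tens \<and> H2 = type_I_U2 smul form lact h2 tens"

definition type_I_pair ::
    "('d::division_ring \<times> 'w1::ab_group_add \<times> 'w2::ab_group_add) itself \<Rightarrow>
      ('f::field \<Rightarrow> 'w::ab_group_add \<Rightarrow> 'w) \<Rightarrow> ('w \<Rightarrow> 'w \<Rightarrow> 'f) \<Rightarrow>
      ('w \<Rightarrow> 'w) set \<Rightarrow> ('w \<Rightarrow> 'w) set \<Rightarrow> bool" where
  "type_I_pair _ smul form H1 H2 \<longleftrightarrow>
     (\<exists>(smulD :: 'f \<Rightarrow> 'd \<Rightarrow> 'd) star (ract :: 'w1 \<Rightarrow> 'd \<Rightarrow> 'w1) eps1 h1
        (lact :: 'd \<Rightarrow> 'w2 \<Rightarrow> 'w2) eps2 h2 tr tens.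
        realizes_type_I smul form H1 H2 smulD star ract eps1 h1 lact eps2 h2 tr tens)"

end

theory Submission
  imports Defs
begin

text \<open>
  All the groups in question stabilise a Lagrangian subspace \<open>X\<close> of \<open>W\<close>: the given one for a pair of
  type II, and \<open>W1 \<otimes> V\<close> with \<open>V\<close> totally isotropic of half the dimension of \<open>W2\<close> in the split
  case of type I. The stabiliser of \<open>X\<close> acts on the Schroedinger model, the smooth functions \<open>\<phi>\<close> on \<open>W\<close>
  with \<open>\<phi> (x + w) = \<psi> (- \<langle>x, w\<rangle> / 2) \<phi> w\<close> for \<open>x \<in> X\<close>, by \<open>\<phi> \<mapsto> \<phi> \<circ> g\<close>, and this is the splitting.
  To transport it to an arbitrary model \<open>S\<close>, one finds a vector of \<open>S\<close> fixed by a pair of dual lattices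
  of \<open>X\<close> and of a complementary Lagrangian \<open>Y\<close>; its translates modulo these lattices are eigenvectors
  of the lattices for distinct characters, hence a basis of \<open>S\<close>, and this basis defines an
  \<open>X\<close>-invariant linear form \<open>\<xi>\<close>. The map sending \<open>v\<close> to \<open>\<lambda>w. \<xi> (\<rho> (w, 0) v)\<close> is then an
  isomorphism of \<open>S\<close> with the Schroedinger model.
\<close>

text \<open>The model consists of functions on all of \<open>W\<close>, not on \<open>Y\<close>,
  because an element of the stabiliser of \<open>X\<close> need not preserve the chosen complement.
  Both conditions on these functions involve only \<open>X\<close>, \<open>form\<close> and the
  topology, so composition with \<open>g\<close> requires no normalising scalar, and no cocycle can
  appear. The coefficients lie in an abstract field, so integrals over lattices become finite sums
  over transversals. Where complex analysis would apply a projector divided by an index, or Fourier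
  inversion, the proof interpolates: \<open>delta_function\<close> builds a function concentrated at
  one coset from the characters that separate the cosets. Duality of \<open>LX s\<close> and
  \<open>LY s\<close> under \<psi> provides enough characters. This is used twice: to show that some
  eigenprojection of a smooth vector is nonzero, and to realise indicators of small lattices, from
  which surjectivity onto the model follows. Injectivity comes from irreducibility.\<close>

section \<open>Characters, cosets and linear algebra over division rings\<close>

text \<open>Lagrange interpolation with the functions \<theta> z as coordinates: multiplying by
  (\<theta> z - \<theta> z s) / (\<theta> z t0 - \<theta> z s) kills the value at \<open>s\<close>
  and keeps the one at \<open>t0\<close>, so the points of \<open>T\<close> are treated one at a
  time. Only differences of values of \<theta> are inverted, never the size of a finite
  quotient.\<close>

lemma delta_function:
  fixes \<theta> :: "'z \<Rightarrow> 't \<Rightarrow> 'r::field"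
  assumes "finite T" and "h \<in> C"
    and add: "\<And>g g'. g \<in> C \<Longrightarrow> g' \<in> C \<Longrightarrow> (\<lambda>t. g t + g' t) \<in> C"
    and scale: "\<And>g a. g \<in> C \<Longrightarrow> (\<lambda>t. a * g t) \<in> C"
    and mult: "\<And>g z. g \<in> C \<Longrightarrow> z \<in> Z \<Longrightarrow> (\<lambda>t. \<theta> z t * g t) \<in> C"
    and sep: "\<And>t. t \<in> T \<Longrightarrow> t \<noteq> t0 \<Longrightarrow> \<exists>z\<in>Z. \<theta> z t \<noteq> \<theta> z t0"
  shows "\<exists>g\<in>C. g t0 = h t0 \<and> (\<forall>t\<in>T - {t0}. g t = 0)"
  using assms(1) sep
proof (induction T)
  case empty
  then show ?case using \<open>h \<in> C\<close> by auto
next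
  case (insert s T)
  then obtain g where g: "g \<in> C" "g t0 = h t0" "\<forall>t\<in>T - {t0}. g t = 0" by auto
  show ?case
  proof (cases "s = t0")
    case True
    then show ?thesis using g by auto
  next
    case False
    then obtain z where z: "z \<in> Z" "\<theta> z s \<noteq> \<theta> z t0" using insert.prems by blast
    let ?a = "1 / (\<theta> z t0 - \<theta> z s)"
    let ?g = "\<lambda>t. ?a * (\<theta> z t * g t + (- \<theta> z s) * g t)"
    have "?g \<in> C" by (intro add scale mult g z)
    moreover have "?g t0 = h t0" using z(2) g(2)
      by (simp add: divide_simps) (simp add: algebra_simps)
    moreover have "\<forall>t\<in>insert s T - {t0}. ?g t = 0" using g(3) by auto
    ultimately show ?thesis by (intro bexI[of _ ?g] conjI)
  qed
qed

text \<open>A relation is shortened by applying \<open>T a\<close> and subtracting the eigenvalue at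
  \<open>b0\<close> times the relation. The operator is chosen anew for each pair to be separated,
  since a single one need not separate all of \<open>B\<close>.\<close>

lemma (in vector_space) independent_eigenvectors:
  assumes lin: "\<And>a. a \<in> A \<Longrightarrow> Vector_Spaces.linear scale scale (T a)"
    and eigen: "\<And>a b. a \<in> A \<Longrightarrow> b \<in> B \<Longrightarrow> \<exists>c. T a b = scale c b"
    and sep: "\<And>b b'. b \<in> B \<Longrightarrow> b' \<in> B \<Longrightarrow> b \<noteq> b' \<Longrightarrow>
      \<exists>a\<in>A. \<exists>c c'. T a b = scale c b \<and> T a b' = scale c' b' \<and> c \<noteq> c'"
    and nz: "0 \<notin> B"
  shows "independent B"
proof -
  \<comment> \<open>Eigenvalues are chosen once. They are unique because the vectors of
    \<open>B\<close> are nonzero, so those supplied by \<open>sep\<close> agree with the chosen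
    ones.\<close>
  define \<theta> where "\<theta> b a = (SOME c. T a b = scale c b)" for b a
  have eigen: "T a b = scale (\<theta> b a) b" if "a \<in> A" "b \<in> B" for a b
    using someI_ex[OF eigen[OF that]] by (simp add: \<theta>_def)
  have sep: "\<exists>a\<in>A. \<theta> b a \<noteq> \<theta> b' a" if bb': "b \<in> B" "b' \<in> B" "b \<noteq> b'" for b b'
  proof -
    obtain a c c' where a: "a \<in> A" "T a b = scale c b" "T a b' = scale c' b'" "c \<noteq> c'"
      using sep[OF bb'] by blast
    have "c = \<theta> b a" "c' = \<theta> b' a"
      using a eigen[OF a(1) bb'(1)] eigen[OF a(1) bb'(2)] bb' nz by (auto simp: scale_cancel_right)
    then show ?thesis using a by blast
  qed
  have *: "\<forall>b\<in>S. c b = 0" if "finite S" "S \<subseteq> B" "(\<Sum>b\<in>S. scale (c b) b) = 0" for S c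
    using that
  proof (induction S arbitrary: c)
    case empty
    then show ?case by simp
  next
    case (insert b0 S)
    have zero: "scale (c b0) b0 + (\<Sum>b\<in>S. scale (c b) b) = 0"
      using insert by simp
    have S0: "c b1 = 0" if b1: "b1 \<in> S" for b1
    proof -
      have "b1 \<noteq> b0" using b1 insert by auto
      then obtain a where a: "a \<in> A" "\<theta> b1 a \<noteq> \<theta> b0 a"
        using sep b1 insert.prems by blast
      interpret Ta: Vector_Spaces.linear scale scale "T a" using lin a by blast
      have "T a (scale (c b0) b0 + (\<Sum>b\<in>S. scale (c b) b)) = 0"
        unfolding zero by (simp add: Ta.zero)
      then have "scale (c b0) (T a b0) + (\<Sum>b\<in>S. scale (c b) (T a b)) = 0"
        by (simp add: Ta.add Ta.sum Ta.scale)
      moreover have "T a b0 = scale (\<theta> b0 a) b0" using eigen a insert by auto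
      moreover have "(\<Sum>b\<in>S. scale (c b) (T a b)) = (\<Sum>b\<in>S. scale (c b * \<theta> b a) b)"
        by (rule sum.cong) (use eigen a insert in auto)
      ultimately have 1: "scale (c b0 * \<theta> b0 a) b0 + (\<Sum>b\<in>S. scale (c b * \<theta> b a) b) = 0" by simp
      have "scale (\<theta> b0 a) (scale (c b0) b0 + (\<Sum>b\<in>S. scale (c b) b)) = 0" unfolding zero by simp
      then have 2: "scale (c b0 * \<theta> b0 a) b0 + (\<Sum>b\<in>S. scale (c b * \<theta> b0 a) b) = 0"
        by (simp add: scale_right_distrib scale_sum_right mult.commute)
      have "(\<Sum>b\<in>S. scale (c b * (\<theta> b a - \<theta> b0 a)) b) =
          (\<Sum>b\<in>S. scale (c b * \<theta> b a) b) - (\<Sum>b\<in>S. scale (c b * \<theta> b0 a) b)"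
        by (simp add: right_diff_distrib scale_left_diff_distrib sum_subtractf)
      also have "\<dots> = 0" using 1 2 by (simp add: add_eq_0_iff)
      finally have "\<forall>b\<in>S. c b * (\<theta> b a - \<theta> b0 a) = 0"
        using insert.IH[of "\<lambda>b. c b * (\<theta> b a - \<theta> b0 a)"] insert.prems by auto
      then show ?thesis using b1 a by auto
    qed
    then have "scale (c b0) b0 = 0" using zero by simp
    moreover have "b0 \<noteq> 0" using insert.prems nz by auto
    ultimately show ?case using S0 by auto
  qed
  show ?thesis
    unfolding dependent_explicit using * by blast
qed

section \<open>Coset representatives and finite transversals\<close>

lemma coset_representatives:
  fixes B :: "'a::ab_group_add set"
  assumes "0 \<in> B" and diff: "\<And>a b. a \<in> B \<Longrightarrow> b \<in> B \<Longrightarrow> a - b \<in> B"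
  obtains r where "\<And>s. s - r s \<in> B" "\<And>s t. s - t \<in> B \<Longrightarrow> r s = r t"
proof -
  define r where "r s = (SOME t. s - t \<in> B)" for s
  have "s - r s \<in> B" for s
    using someI_ex[of "\<lambda>t. s - t \<in> B"] assms(1) unfolding r_def by (metis diff_self)
  moreover have "r s = r t" if st: "s - t \<in> B" for s t
  proof -
    have "t - s \<in> B" using diff[OF assms(1) st] by simp
    then have "s - u \<in> B \<longleftrightarrow> t - u \<in> B" for u
      using diff[of "s - u" "s - t"] diff[of "t - u" "t - s"] st by auto
    then show ?thesis unfolding r_def by simp
  qed
  ultimately show thesis by (rule that)
qed

text \<open>The points of \<open>T0\<close> come from a covering: they may lie outside
  \<open>S\<close>, and several may represent one coset. \<open>r\<close> moves a point whose coset
  meets \<open>S\<close> into \<open>S\<close>, and \<open>h\<close> selects such a point as a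
  function of the coset alone.\<close>

lemma finite_transversal:
  fixes B S :: "'a::ab_group_add set"
  assumes "finite T0" and cover: "\<And>s. s \<in> S \<Longrightarrow> \<exists>t\<in>T0. s - t \<in> B"
    and sub: "0 \<in> B" "\<And>a b. a \<in> B \<Longrightarrow> b \<in> B \<Longrightarrow> a - b \<in> B"
  obtains T where "finite T" "T \<subseteq> S" "\<And>s. s \<in> S \<Longrightarrow> \<exists>!t. t \<in> T \<and> s - t \<in> B"
proof -
  have neg: "- a \<in> B" if "a \<in> B" for a using sub(2)[OF sub(1) that] by simp
  have add: "a + b \<in> B" if "a \<in> B" "b \<in> B" for a b using sub(2)[OF that(1) neg[OF that(2)]] by simp
  define T1 where "T1 = {t\<in>T0. \<exists>s\<in>S. s - t \<in> B}"
  define r where "r t = (SOME s. s \<in> S \<and> s - t \<in> B)" for t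
  define h where "h t = r (SOME t'. t' \<in> T1 \<and> t - t' \<in> B)" for t
  have r: "r t \<in> S" "r t - t \<in> B" if "t \<in> T1" for t
    using someI_ex[of "\<lambda>s. s \<in> S \<and> s - t \<in> B"] that unfolding r_def T1_def by blast+
  have h: "h t \<in> S" "h t - t \<in> B" if t: "t \<in> S" for t
  proof -
    have "\<exists>t'. t' \<in> T1 \<and> t - t' \<in> B" using cover[OF t] t unfolding T1_def by blast
    from someI_ex[OF this] obtain t' where t': "t' \<in> T1" "t - t' \<in> B" "h t = r t'"
      unfolding h_def by blast
    show "h t \<in> S" "h t - t \<in> B"
      using r[OF t'(1)] t' sub(2)[OF r(2)[OF t'(1)] t'(2)] by (auto simp: algebra_simps)
  qed
  have heq: "h s = h t" if "s - t \<in> B" for s t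
  proof -
    have "s - t' \<in> B \<longleftrightarrow> t - t' \<in> B" for t'
      using sub(2)[of "s - t'" "s - t"] add[of "t - t'" "s - t"] that by (auto simp: algebra_simps)
    then show ?thesis unfolding h_def by simp
  qed
  have "h ` S \<subseteq> r ` T1"
  proof
    fix x assume "x \<in> h ` S"
    then obtain t where t: "t \<in> S" "x = h t" by blast
    have "\<exists>t'. t' \<in> T1 \<and> t - t' \<in> B" using cover[OF t(1)] t unfolding T1_def by blast
    from someI_ex[OF this] show "x \<in> r ` T1" unfolding t(2) h_def by blast
  qed
  moreover have "finite T1" using \<open>finite T0\<close> unfolding T1_def by simp
  ultimately have "finite (h ` S)" using finite_subset by blast
  moreover have "\<exists>!t. t \<in> h ` S \<and> s - t \<in> B" if s: "s \<in> S" for s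
  proof
    show "h s \<in> h ` S \<and> s - h s \<in> B" using s h[OF s] neg by force
    fix t assume t: "t \<in> h ` S \<and> s - t \<in> B"
    then obtain u where u: "u \<in> S" "t = h u" by blast
    have "s - u \<in> B" using add[of "s - t" "h u - u"] t h(2)[OF u(1)] u(2) by simp
    from heq[OF this] show "t = h s" using u by simp
  qed
  moreover have "h ` S \<subseteq> S" using h by blast
  ultimately show thesis using that by blast
qed

text \<open>Translation by \<open>x\<close> permutes the classes of \<open>S\<close> modulo
  \<open>B\<close>, on which \<open>g\<close> is constant. This gives sums over a transversal the
  translation invariance of an integral.\<close>

lemma transversal_reindex:
  fixes B S T :: "'a::ab_group_add set" and g :: "'a \<Rightarrow> 'b::comm_monoid_add"
  assumes "finite T" "T \<subseteq> S" and tr: "\<And>s. s \<in> S \<Longrightarrow> \<exists>!t. t \<in> T \<and> s - t \<in> B"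
    and S: "\<And>a b. a \<in> S \<Longrightarrow> b \<in> S \<Longrightarrow> a + b \<in> S"
    and B: "0 \<in> B" "\<And>a b. a \<in> B \<Longrightarrow> b \<in> B \<Longrightarrow> a - b \<in> B"
    and x: "x \<in> S" and per: "\<And>s t. s \<in> S \<Longrightarrow> t \<in> S \<Longrightarrow> s - t \<in> B \<Longrightarrow> g s = g t"
  shows "(\<Sum>t\<in>T. g (x + t)) = (\<Sum>t\<in>T. g t)"
proof -
  define r where "r s = (THE t. t \<in> T \<and> s - t \<in> B)" for s
  have r: "r s \<in> T" "s - r s \<in> B" if "s \<in> S" for s
    using theI'[OF tr[OF that]] unfolding r_def by auto
  have xt: "x + t \<in> S" if "t \<in> T" for t using S x \<open>T \<subseteq> S\<close> that by blast
  have inj: "inj_on (\<lambda>t. r (x + t)) T"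
  proof (rule inj_onI)
    fix s t assume st: "s \<in> T" "t \<in> T" "r (x + s) = r (x + t)"
    have "(x + s - r (x + s)) - (x + t - r (x + t)) \<in> B"
      using r(2)[OF xt[OF st(1)]] r(2)[OF xt[OF st(2)]] B(2) by blast
    then have "s - t \<in> B" using st(3) by simp
    moreover have "s - s \<in> B" using B by simp
    ultimately show "s = t" using tr[of s] st \<open>T \<subseteq> S\<close> by blast
  qed
  have "(\<lambda>t. r (x + t)) ` T = T"
    by (rule endo_inj_surj[OF \<open>finite T\<close> _ inj]) (use r xt in auto)
  then have "bij_betw (\<lambda>t. r (x + t)) T T" using inj unfolding bij_betw_def by blast
  from sum.reindex_bij_betw[OF this, of g] have "(\<Sum>t\<in>T. g t) = (\<Sum>t\<in>T. g (r (x + t)))" by simp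
  also have "\<dots> = (\<Sum>t\<in>T. g (x + t))"
    by (rule sum.cong) (use per[OF xt] r xt \<open>T \<subseteq> S\<close> in \<open>auto intro!: per[symmetric]\<close>)
  finally show ?thesis by simp
qed

text \<open>
  The pairing takes values in a division ring; \<open>ract\<close> is whatever operation the pairing
  turns into multiplication from the right, so the lemma covers bilinear and sesquilinear forms.
\<close>

lemma dual_family:
  fixes \<beta> :: "'x::ab_group_add \<Rightarrow> 'u::ab_group_add \<Rightarrow> 'd::division_ring"
    and act :: "'d \<Rightarrow> 'x \<Rightarrow> 'x" and v :: "'i \<Rightarrow> 'x"
  assumes add_left: "\<And>x x' u. \<beta> (x + x') u = \<beta> x u + \<beta> x' u"
    and add_right: "\<And>x u u'. \<beta> x (u + u') = \<beta> x u + \<beta> x u'"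
    and act: "\<And>d x u. \<beta> (act d x) u = d * \<beta> x u"
    and ract: "\<And>d x u. \<beta> x (ract u d) = \<beta> x u * d"
    and nondeg: "\<And>x. (\<forall>u. \<beta> x u = 0) \<Longrightarrow> x = 0"
    and "finite J"
    and indep: "\<And>c. (\<Sum>j\<in>J. act (c j) (v j)) = 0 \<Longrightarrow> \<forall>j\<in>J. c j = 0"
  shows "\<exists>u. \<forall>i\<in>J. \<forall>j\<in>J. \<beta> (v i) (u j) = (if i = j then 1 else 0)"
  using \<open>finite J\<close> indep
proof (induction J)
  case empty
  then show ?case by simp
next
  case (insert k J)
  \<comment> \<open>No module laws are assumed for \<open>act\<close>; this one and
    \<open>neg1\<close> are deduced from nondegeneracy.\<close>
  have act0: "act 0 x = 0" for x by (rule nondeg) (simp add: act)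
  have "Modules.additive (\<lambda>x. \<beta> x u)" for u by (simp add: Modules.additive.intro add_left)
  then have diff_left: "\<beta> (x - x') u = \<beta> x u - \<beta> x' u"
      and sum_left: "\<beta> (\<Sum>j\<in>I. f j) u = (\<Sum>j\<in>I. \<beta> (f j) u)" for x x' u I and f :: "'i \<Rightarrow> 'x"
    using Modules.additive.diff Modules.additive.sum by fastforce+
  have "Modules.additive (\<beta> x)" for x by (simp add: Modules.additive.intro add_right)
  then have diff_right: "\<beta> x (u - u') = \<beta> x u - \<beta> x u'"
      and sum_right: "\<beta> x (\<Sum>j\<in>I. g j) = (\<Sum>j\<in>I. \<beta> x (g j))" for x u u' I and g :: "'i \<Rightarrow> 'u"
    using Modules.additive.diff Modules.additive.sum by fastforce+
  have indep: "\<forall>j\<in>J. c j = 0" if "(\<Sum>j\<in>J. act (c j) (v j)) = 0" for c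
  proof -
    have "(\<Sum>j\<in>J. act ((c(k := 0)) j) (v j)) = (\<Sum>j\<in>J. act (c j) (v j))"
      by (rule sum.cong) (use insert.hyps in auto)
    then have "(\<Sum>j\<in>insert k J. act ((c(k := 0)) j) (v j)) = 0"
      using that insert.hyps by (simp add: act0)
    from insert.prems[OF this] show ?thesis using insert.hyps by (auto split: if_splits)
  qed
  obtain u where u: "\<forall>i\<in>J. \<forall>j\<in>J. \<beta> (v i) (u j) = (if i = j then 1 else 0)"
    using insert.IH[OF indep] ..
  \<comment> \<open>Otherwise \<beta> (v k) vanishes on the common kernel of the \<beta> (v j).
    Projecting an arbitrary \<open>y\<close> to that kernel then shows that \<open>v k\<close> is
    the combination of the \<open>v j\<close> with coefficients \<beta> (v k) (u j), against
    independence.\<close>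
  have "\<exists>y. (\<forall>i\<in>J. \<beta> (v i) y = 0) \<and> \<beta> (v k) y \<noteq> 0"
  proof (rule ccontr)
    assume neg: "\<not> ?thesis"
    define x where "x = (\<Sum>j\<in>J. act (\<beta> (v k) (u j)) (v j))"
    have "\<beta> (v k - x) y = 0" for y
    proof -
      define y' where "y' = y - (\<Sum>j\<in>J. ract (u j) (\<beta> (v j) y))"
      have *: "\<beta> z y' = \<beta> z y - (\<Sum>j\<in>J. \<beta> z (u j) * \<beta> (v j) y)" for z
        unfolding y'_def by (simp add: diff_right sum_right ract)
      have "\<forall>i\<in>J. \<beta> (v i) y' = 0"
      proof
        fix i assume i: "i \<in> J"
        have "(\<Sum>j\<in>J. \<beta> (v i) (u j) * \<beta> (v j) y) = (\<Sum>j\<in>J. if j = i then \<beta> (v i) y else 0)"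
          by (rule sum.cong) (use u i in auto)
        then show "\<beta> (v i) y' = 0" using i insert.hyps by (simp add: *)
      qed
      then have "\<beta> (v k) y' = 0" using neg by blast
      then show ?thesis by (simp add: * x_def diff_left sum_left act)
    qed
    then have "v k - x = 0" by (intro nondeg) simp
    define c where "c j = (if j = k then -1 else \<beta> (v k) (u j))" for j
    have neg1: "act (-1) z = - z" for z
    proof -
      have "act (-1) z + z = 0" by (rule nondeg) (simp add: add_left act)
      then show ?thesis by (simp add: eq_neg_iff_add_eq_0)
    qed
    have "(\<Sum>j\<in>J. act (c j) (v j)) = x" unfolding x_def
      by (rule sum.cong) (use insert.hyps in \<open>auto simp: c_def\<close>)
    then have "(\<Sum>j\<in>insert k J. act (c j) (v j)) = - v k + x"
      using insert.hyps by (simp add: c_def neg1)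
    then have "(\<Sum>j\<in>insert k J. act (c j) (v j)) = 0" using \<open>v k - x = 0\<close> by simp
    from insert.prems[OF this] have "c k = 0" by blast
    then show False by (simp add: c_def)
  qed
  then obtain y where y: "\<And>i. i \<in> J \<Longrightarrow> \<beta> (v i) y = 0" "\<beta> (v k) y \<noteq> 0" by blast
  define uk where "uk = ract y (inverse (\<beta> (v k) y))"
  have uk: "\<beta> (v i) uk = (if i = k then 1 else 0)" if "i \<in> insert k J" for i
    using that y insert.hyps by (auto simp: uk_def ract)
  define u' where "u' j = (if j = k then uk else u j - ract uk (\<beta> (v k) (u j)))" for j
  have "\<beta> (v i) (u' j) = (if i = j then 1 else 0)" if "i \<in> insert k J" "j \<in> insert k J" for i j
    using that uk u insert.hyps by (auto simp: u'_def diff_right ract)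
  then show ?case by blast
qed

section \<open>Dimension counting in left spaces over a division ring\<close>

lemma (in left_D_space) lact_zero [simp]: "lact 0 x = 0" "lact d 0 = 0"
  using lact_add_left[of 0 0 x] lact_add_right[of d 0 0] by simp_all

lemma (in left_D_space) lact_uminus: "lact (- d) x = - lact d x"
  using lact_add_left[of d "- d" x] by (simp add: eq_neg_iff_add_eq_0 add.commute)

lemma (in left_D_space) lact_diff_left: "lact (d - e) x = lact d x - lact e x"
  using lact_add_left[of d "- e" x] by (simp add: lact_uminus)

lemma (in left_D_space) lact_diff_right: "lact d (x - y) = lact d x - lact d y"
  using lact_add_right[of d "x - y" y] by (simp add: algebra_simps)

lemma (in left_D_space) lact_sum_right: "lact d (\<Sum>i\<in>I. f i) = (\<Sum>i\<in>I. lact d (f i))"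
  by (induction I rule: infinite_finite_induct) (auto simp: lact_add_right)

lemma (in left_D_space) lact_sum_left: "lact (\<Sum>i\<in>I. f i) x = (\<Sum>i\<in>I. lact (f i) x)"
  by (induction I rule: infinite_finite_induct) (auto simp: lact_add_left)

text \<open>Elimination: a member with nonzero coordinate at \<open>b\<close> serves as pivot, and
  subtracting multiples of it moves the other members into the span of the smaller \<open>B\<close>.
  Counting indices instead of vectors spares any discussion of repeated members.\<close>

lemma (in left_D_space) card_independent_family_le:
  fixes f :: "'i \<Rightarrow> 'x"
  assumes "finite B" "finite J" "\<And>j. j \<in> J \<Longrightarrow> f j \<in> D_span lact B"
    and indep: "\<And>c. (\<Sum>j\<in>J. lact (c j) (f j)) = 0 \<Longrightarrow> \<forall>j\<in>J. c j = 0"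
  shows "card J \<le> card B"
  using assms
proof (induction B arbitrary: J f)
  case empty
  \<comment> \<open>All members are 0 here, so independence applied to the coefficients 1 leaves
    only the empty family.\<close>
  have "(\<Sum>j\<in>J. lact 1 (f j)) = 0" using empty.prems(2) by (auto simp: D_span_def)
  from empty.prems(3)[OF this] show ?case by auto
next
  case (insert b B)
  have "\<exists>a s. f j = lact a b + s \<and> s \<in> D_span lact B" if "j \<in> J" for j
  proof -
    have "f j \<in> D_span lact (insert b B)" using insert.prems(2) that by blast
    then obtain c where "f j = (\<Sum>x\<in>insert b B. lact (c x) x)"
      by (auto simp: D_span_def)
    then have "f j = lact (c b) b + (\<Sum>x\<in>B. lact (c x) x)" using insert.hyps by simp
    then show ?thesis unfolding D_span_def by blast
  qed
  then obtain a s where fj: "\<And>j. j \<in> J \<Longrightarrow> f j = lact (a j) b + s j"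
    and s: "\<And>j. j \<in> J \<Longrightarrow> s j \<in> D_span lact B"
    by metis
  show ?case
  proof (cases "\<forall>j\<in>J. a j = 0")
    case True
    then have "card J \<le> card B" using s fj insert.prems insert.IH[of J f] by simp
    then show ?thesis using insert.hyps by simp
  next
    case False
    then obtain k where k: "k \<in> J" "a k \<noteq> 0" by blast
    define q where "q j = a j * inverse (a k)" for j
    define f' where "f' j = f j - lact (q j) (f k)" for j
    have "f' j \<in> D_span lact B" if j: "j \<in> J - {k}" for j
    proof -
      obtain c where c: "s j = (\<Sum>b\<in>B. lact (c b) b)" using s j by (auto simp: D_span_def)
      obtain d where d: "s k = (\<Sum>b\<in>B. lact (d b) b)" using s k by (auto simp: D_span_def)
      have "q j * a k = a j" using k by (simp add: q_def mult.assoc)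
      then have "f' j = s j - lact (q j) (s k)"
        using fj j k by (simp add: f'_def lact_add_right lact_lact)
      also have "\<dots> = (\<Sum>b\<in>B. lact (c b - q j * d b) b)"
        by (simp add: c d lact_diff_left lact_sum_right lact_lact sum_subtractf)
      finally show ?thesis unfolding D_span_def by (intro CollectI exI[of _ "\<lambda>b. c b - q j * d b"] conjI TrueI)
    qed
    moreover have "\<forall>j\<in>J - {k}. c j = 0" if c: "(\<Sum>j\<in>J - {k}. lact (c j) (f' j)) = 0" for c
    proof -
      \<comment> \<open>The coefficient at the pivot is the one that turns a relation among the
        \<open>f' j\<close> into a relation among the \<open>f j\<close>.\<close>
      define c' where "c' j = (if j = k then - (\<Sum>j\<in>J - {k}. c j * q j) else c j)" for j
      have "(\<Sum>j\<in>J. lact (c' j) (f j)) = lact (c' k) (f k) + (\<Sum>j\<in>J - {k}. lact (c' j) (f j))"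
        using k insert.prems by (simp add: sum.remove)
      also have "(\<Sum>j\<in>J - {k}. lact (c' j) (f j)) = (\<Sum>j\<in>J - {k}. lact (c j) (f j))"
        by (rule sum.cong) (auto simp: c'_def)
      also have "lact (c' k) (f k) + \<dots> = (\<Sum>j\<in>J - {k}. lact (c j) (f' j))"
        by (simp add: c'_def f'_def lact_uminus lact_sum_left lact_diff_right lact_lact sum_subtractf)
      finally have "\<forall>j\<in>J. c' j = 0" using c insert.prems(3) by simp
      then show ?thesis by (auto simp: c'_def split: if_splits)
    qed
    ultimately have "card (J - {k}) \<le> card B"
      using insert.IH[of "J - {k}" f'] insert.prems by simp
    then show ?thesis using insert.hyps k insert.prems(1) by simp
  qed
qed

section \<open>Lattices in a symplectic space over a local field\<close>

context nonarch_local_field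
begin

lemma abs_zero [simp]: "absF 0 = 0"
  by (simp add: abs_eq_0_iff)

lemma abs_pos: "x \<noteq> 0 \<Longrightarrow> 0 < absF x"
  using abs_nonneg[of x] abs_eq_0_iff[of x] by linarith

lemma abs_one [simp]: "absF 1 = 1"
  using abs_mult[of 1 1] abs_pos[of 1] by simp

lemma abs_minus [simp]: "absF (- x) = absF x"
proof -
  have "absF (-1) * absF (-1) = 1" using abs_mult[of "-1" "-1"] by simp
  then have "absF (-1) = 1"
    using abs_nonneg[of "-1"] by (auto simp: square_eq_1_iff)
  then show ?thesis using abs_mult[of "-1" x] by simp
qed

lemma abs_inverse: "x \<noteq> 0 \<Longrightarrow> absF (inverse x) = inverse (absF x)"
  using abs_mult[of x "inverse x"] abs_pos[of x] by (simp add: field_simps)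

lemma abs_divide: "y \<noteq> 0 \<Longrightarrow> absF (x / y) = absF x / absF y"
  by (simp add: divide_inverse abs_mult abs_inverse)

lemma abs_power: "absF (x ^ n) = absF x ^ n"
  by (induction n) (auto simp: abs_mult)

lemma abs_diff_le: "absF (x - y) \<le> max (absF x) (absF y)"
  using abs_ultrametric[of x "- y"] by simp

lemma metric: "Metric_space UNIV (\<lambda>x y. absF (x - y))"
proof
  fix x y z :: 'f
  show "0 \<le> absF (x - y)" by (rule abs_nonneg)
  show "absF (x - y) = absF (y - x)" using abs_minus[of "x - y"] by simp
  show "absF (x - y) = 0 \<longleftrightarrow> x = y" by (simp add: abs_eq_0_iff)
  show "absF (x - z) \<le> absF (x - y) + absF (y - z)"
    using abs_ultrametric[of "x - y" "y - z"] abs_nonneg[of "x - y"] abs_nonneg[of "y - z"] by simp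
qed

lemma exists_abs_less: "\<epsilon> > 0 \<Longrightarrow> \<exists>x. x \<noteq> 0 \<and> absF x < \<epsilon>"
proof -
  assume "\<epsilon> > 0"
  obtain x where x: "x \<noteq> 0" "absF x \<noteq> 1" using abs_nontrivial by blast
  define y where "y = (if absF x < 1 then x else inverse x)"
  have "y \<noteq> 0" "absF y < 1"
    using x abs_pos[of x] by (auto simp: y_def abs_inverse inverse_less_1_iff)
  moreover obtain n where "absF y ^ n < \<epsilon>" using real_arch_pow_inv[OF \<open>\<epsilon> > 0\<close> \<open>absF y < 1\<close>] by blast
  ultimately show ?thesis by (intro exI[of _ "y ^ n"]) (simp add: abs_power)
qed

lemma exists_abs_greater: "\<exists>x. x \<noteq> 0 \<and> r < absF x"
proof -
  have "inverse (max r 1) > 0" by (simp add: less_max_iff_disj)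
  from exists_abs_less[OF this] obtain x where x: "x \<noteq> 0" "absF x < inverse (max r 1)"
    by blast
  then have "max r 1 < inverse (absF x)"
    using less_imp_inverse_less[OF x(2) abs_pos[OF x(1)]] by simp
  then show ?thesis using x by (intro exI[of _ "inverse x"]) (simp add: abs_inverse)
qed

text \<open>Here local compactness enters: a compact neighbourhood of 0 is totally bounded, and
  every ball can be scaled into it.\<close>

lemma bounded_finite_cover:
  assumes "\<epsilon> > 0"
  obtains T where "finite T" "\<And>a. absF a \<le> r \<Longrightarrow> \<exists>t\<in>T. absF (a - t) < \<epsilon>"
proof -
  interpret M: Metric_space UNIV "\<lambda>x y. absF (x - y)" by (rule metric)
  have "0 \<in> topspace (abs_topology absF)" by (simp add: abs_topology_def)
  then obtain U K where UK: "openin (abs_topology absF) U" "compactin (abs_topology absF) K" "0 \<in> U" "U \<subseteq> K"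
    using locally_compact unfolding locally_compact_space_def by blast
  obtain \<delta> where \<delta>: "\<delta> > 0" "M.mball 0 \<delta> \<subseteq> U"
    using UK(1,3) unfolding abs_topology_def M.openin_mtopology by blast
  have tb: "M.mtotally_bounded K"
    using UK(2) unfolding abs_topology_def by (rule M.compactin_imp_mtotally_bounded)
  \<comment> \<open>Multiplication by \<open>b\<close> sends the ball of radius \<open>r\<close>
    into the ball of radius \<delta> inside \<open>K\<close>; \<open>max r 1\<close> keeps the
    quotient positive for every \<open>r\<close>.\<close>
  obtain b where b: "b \<noteq> 0" "absF b < \<delta> / max r 1"
    using exists_abs_less[of "\<delta> / max r 1"] \<delta>(1) by auto
  have bp: "absF b > 0" using abs_pos b by blast
  obtain T where T: "finite T" "K \<subseteq> (\<Union>t\<in>T. M.mball t (\<epsilon> * absF b))"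
    using tb bp assms unfolding M.mtotally_bounded_def by (meson mult_pos_pos)
  show thesis
  proof
    show "finite ((\<lambda>t. t / b) ` T)" using T(1) by simp
    fix a assume a: "absF a \<le> r"
    have "absF (b * a) \<le> absF b * max r 1"
      using a bp by (simp add: abs_mult)
    also have "\<dots> < \<delta>" using b(2) by (simp add: field_simps)
    finally have "b * a \<in> M.mball 0 \<delta>" by (simp add: M.in_mball)
    then obtain t where "t \<in> T" "b * a \<in> M.mball t (\<epsilon> * absF b)"
      using \<delta>(2) UK(4) T(2) by blast
    then have t: "t \<in> T" "absF (t - b * a) < \<epsilon> * absF b" by (simp_all add: M.in_mball)
    have "absF (a - t / b) = absF ((b * a - t) / b)" using b by (simp add: field_simps)
    also have "\<dots> = absF (t - b * a) / absF b"
      using b(1) abs_minus[of "t - b * a"] by (simp add: abs_divide)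
    also have "\<dots> < \<epsilon>" using t(2) bp by (simp add: field_simps)
    finally show "\<exists>t\<in>(\<lambda>t. t / b) ` T. absF (a - t) < \<epsilon>" using t(1) by blast
  qed
qed

end

section \<open>A smooth character and its conductor\<close>

locale local_field_character = nonarch_local_field absF p
  for absF :: "'f::field \<Rightarrow> real" and p :: nat +
  fixes \<psi> :: "'f \<Rightarrow> 'r::field"
  assumes smooth_character: "smooth_character absF \<psi>" and psi_nontrivial: "\<exists>x. \<psi> x \<noteq> 1"
begin

lemma psi_zero [simp]: "\<psi> 0 = 1" and psi_add: "\<psi> (x + y) = \<psi> x * \<psi> y"
  using smooth_character unfolding smooth_character_def by auto

lemma psi_mult_minus [simp]: "\<psi> x * \<psi> (- x) = 1" "\<psi> (- x) * \<psi> x = 1"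
  using psi_add[of x "- x"] by (simp_all add: mult.commute)

lemma psi_nonzero [simp]: "\<psi> x \<noteq> 0"
  using psi_mult_minus[of x] by fastforce

lemma psi_minus: "\<psi> (- x) = inverse (\<psi> x)"
  by (metis inverse_unique psi_mult_minus(1))

lemma psi_minus_eq_one [simp]: "\<psi> (- x) = 1 \<longleftrightarrow> \<psi> x = 1"
  by (simp add: psi_minus)

lemma psi_sum: "(\<And>i. i \<in> I \<Longrightarrow> \<psi> (g i) = 1) \<Longrightarrow> \<psi> (\<Sum>i\<in>I. g i) = 1"
  by (induction I rule: infinite_finite_induct) (auto simp: psi_add)

text \<open>The fractional ideal dual to the ring of integers under the pairing \<psi> (a * c), that
  is, the largest one on which \<psi> is trivial. Working with the set itself avoids choosing a
  generator.\<close>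

definition conductor :: "'f set" where
  "conductor = {c. \<forall>a. absF a \<le> 1 \<longrightarrow> \<psi> (a * c) = 1}"

lemma conductor_zero [simp]: "0 \<in> conductor"
  by (simp add: conductor_def)

lemma conductor_diff: "c \<in> conductor \<Longrightarrow> d \<in> conductor \<Longrightarrow> c - d \<in> conductor"
  using psi_add[of "a * c" "- (a * d)" for a] by (simp add: conductor_def right_diff_distrib)

lemma conductor_scale: "absF a \<le> 1 \<Longrightarrow> c \<in> conductor \<Longrightarrow> a * c \<in> conductor"
  using mult_le_one[of "absF b" "absF a" for b] abs_nonneg
  by (auto simp: conductor_def abs_mult mult.assoc[symmetric])

lemma conductor_open: "\<exists>\<epsilon>>0. \<forall>c. absF c < \<epsilon> \<longrightarrow> c \<in> conductor"
proof -
  interpret M: Metric_space UNIV "\<lambda>x y. absF (x - y)" by (rule metric)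
  have "openin M.mtopology {x. \<psi> x = 1}"
    using smooth_character unfolding smooth_character_def abs_topology_def by blast
  moreover have "0 \<in> {x. \<psi> x = 1}" by simp
  ultimately obtain \<epsilon> where \<epsilon>: "\<epsilon> > 0" "M.mball 0 \<epsilon> \<subseteq> {x. \<psi> x = 1}"
    unfolding M.openin_mtopology by blast
  have "\<psi> (a * c) = 1" if "absF c < \<epsilon>" "absF a \<le> 1" for a c
  proof -
    have "absF (a * c) < \<epsilon>"
      using that mult_left_le_one_le[of "absF c" "absF a"] abs_nonneg[of a] abs_nonneg[of c]
      by (simp add: abs_mult)
    then have "a * c \<in> M.mball 0 \<epsilon>" by (simp add: M.in_mball)
    then show ?thesis using \<epsilon>(2) by blast
  qed
  then show ?thesis using \<epsilon>(1) unfolding conductor_def by blast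
qed

text \<open>If \<psi> z is not 1, an element of the conductor at least as large as \<open>z\<close>
  would have \<open>z\<close> as an integral multiple.\<close>

lemma conductor_bounded: "\<exists>r>0. \<forall>c\<in>conductor. absF c < r"
proof -
  obtain z where z: "\<psi> z \<noteq> 1" using psi_nontrivial by blast
  have "absF c < absF z" if c: "c \<in> conductor" for c
  proof (rule ccontr)
    assume "\<not> ?thesis"
    moreover have "z \<noteq> 0" using z by auto
    ultimately have "c \<noteq> 0" using abs_pos[of z] by auto
    moreover from this have "absF (z / c) \<le> 1"
      using \<open>\<not> absF c < absF z\<close> abs_pos[of c] by (simp add: abs_divide)
    ultimately have "\<psi> (z / c * c) = 1" using c unfolding conductor_def by blast
    then show False using z \<open>c \<noteq> 0\<close> by simp
  qed
  moreover have "z \<noteq> 0" using z by auto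
  ultimately show ?thesis using abs_pos by blast
qed

text \<open>
  The ring of integers is its own double dual: if \<open>b\<close> maps the conductor \<open>K\<close> into \<open>K\<close>,
  then so do all powers of \<open>b\<close>, and \<open>K\<close> is bounded.
\<close>

lemma conductor_dual:
  assumes "\<And>c. c \<in> conductor \<Longrightarrow> \<psi> (b * c) = 1"
  shows "absF b \<le> 1"
proof (rule ccontr)
  assume b: "\<not> ?thesis"
  have mult: "b * c \<in> conductor" if "c \<in> conductor" for c
    using assms[OF conductor_scale[OF _ that]] by (auto simp: conductor_def mult.left_commute)
  obtain c where c: "c \<noteq> 0" "c \<in> conductor" using conductor_open exists_abs_less by metis
  have pow: "b ^ n * c \<in> conductor" for n
    by (induction n) (use c mult in \<open>auto simp: mult.assoc\<close>)
  obtain r where r: "\<And>c. c \<in> conductor \<Longrightarrow> absF c < r" using conductor_bounded by blast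
  obtain n where "r / absF c < absF b ^ n" using real_arch_pow[of "absF b"] b by auto
  then have "r < absF (b ^ n * c)"
    using abs_pos[OF c(1)] by (simp add: abs_mult abs_power field_simps)
  then show False using r[OF pow[of n]] by simp
qed

end

lemma two_nonzero:
  assumes "CHAR('f::field) \<noteq> 2"
  shows "(2::'f) \<noteq> 0"
proof
  assume "(2::'f) = 0"
  then have "CHAR('f) dvd 2" using of_nat_eq_0_iff_char_dvd[of 2, where 'a = 'f] by simp
  then have "CHAR('f) = 1" using assms by (metis prime_nat_iff two_is_prime_nat)
  then show False by simp
qed

section \<open>Symplectic bases adapted to a Lagrangian subspace\<close>

context symplectic_space
begin

lemma form_add_left: "form (x + y) w = form x w + form y w"
  and form_scale_left: "form (smul a x) w = a * form x w"
  and form_sum_left: "form (\<Sum>i\<in>I. g i) w = (\<Sum>i\<in>I. form (g i) w)"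
  and form_zero_left [simp]: "form 0 w = 0"
  and form_minus_left: "form (- x) w = - form x w"
  and form_diff_left: "form (x - y) w = form x w - form y w"
proof -
  interpret l: Vector_Spaces.linear smul "(*)" "\<lambda>x. form x w" by (rule form_linear_left)
  show "form (x + y) w = form x w + form y w" "form (smul a x) w = a * form x w"
    "form (\<Sum>i\<in>I. g i) w = (\<Sum>i\<in>I. form (g i) w)" "form 0 w = 0" "form (- x) w = - form x w"
    "form (x - y) w = form x w - form y w"
    by (simp_all add: l.add l.scale l.sum l.zero l.neg l.diff)
qed

lemma form_add_right: "form w (x + y) = form w x + form w y"
  and form_scale_right: "form w (smul a x) = a * form w x"
  and form_sum_right: "form w (\<Sum>i\<in>I. g i) = (\<Sum>i\<in>I. form w (g i))"
  and form_zero_right [simp]: "form w 0 = 0"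
  and form_diff_right: "form w (x - y) = form w x - form w y"
proof -
  interpret l: Vector_Spaces.linear smul "(*)" "form w" by (rule form_linear_right)
  show "form w (x + y) = form w x + form w y" "form w (smul a x) = a * form w x"
    "form w (\<Sum>i\<in>I. g i) = (\<Sum>i\<in>I. form w (g i))" "form w 0 = 0"
    "form w (x - y) = form w x - form w y"
    by (simp_all add: l.add l.scale l.sum l.zero l.neg l.diff)
qed

lemma form_swap: "form w w' = - form w' w"
proof -
  have "form (w + w') (w + w') = form w w + form w w' + (form w' w + form w' w')"
    by (simp only: form_add_left form_add_right ac_simps)
  then show ?thesis by (simp add: form_alternating eq_neg_iff_add_eq_0)
qed

text \<open>A family dual to a basis of \<open>X\<close> is determined only modulo \<open>X\<close>,
  which leaves room to correct it inside \<open>X\<close> until it is isotropic. The correction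
  halves a Gram matrix, hence the condition on the characteristic.\<close>

lemma lagrangian_symplectic_basis:
  assumes char: "CHAR('f) \<noteq> 2" and X: "subspace X"
    and iso: "\<And>x x'. x \<in> X \<Longrightarrow> x' \<in> X \<Longrightarrow> form x x' = 0"
    and coiso: "\<And>w. (\<forall>x\<in>X. form x w = 0) \<Longrightarrow> w \<in> X"
  obtains E f where "finite E" "E \<subseteq> X" "X = {w. \<forall>e\<in>E. form e w = 0}"
    "\<And>e e'. e \<in> E \<Longrightarrow> e' \<in> E \<Longrightarrow> form (f e) (f e') = 0"
    "\<And>e e'. e \<in> E \<Longrightarrow> e' \<in> E \<Longrightarrow> form e (f e') = (if e = e' then 1 else 0)"
    "\<And>w. w = (\<Sum>e\<in>E. smul (form w (f e)) e) + (\<Sum>e\<in>E. smul (form e w) (f e))"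
proof -
  obtain Basis where "finite_dimensional_vector_space smul Basis"
    using finite_dimensional by blast
  then interpret fd: finite_dimensional_vector_space smul Basis .
  note two = two_nonzero[OF char]
  obtain E where E: "E \<subseteq> X" "independent E" "X \<subseteq> span E" using maximal_independent_subset[of X] by metis
  have fin: "finite E" using E(2) fd.finiteI_independent by blast
  have "\<exists>u. \<forall>i\<in>E. \<forall>j\<in>E. form i (u j) = (if i = j then 1 else 0)"
  proof (rule dual_family[where act = smul and ract = "\<lambda>u d. smul d u" and v = "\<lambda>e. e"])
    show "finite E" by (rule fin)
    fix c assume "(\<Sum>j\<in>E. smul (c j) j) = 0"
    then show "\<forall>j\<in>E. c j = 0" using E(2) fin unfolding dependent_finite[OF fin] by blast
  qed (auto simp: form_add_left form_add_right form_scale_left form_scale_right mult.commute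
        intro: form_nondegenerate)
  then obtain u where u: "\<And>i j. i \<in> E \<Longrightarrow> j \<in> E \<Longrightarrow> form i (u j) = (if i = j then 1 else 0)" by metis
  \<comment> \<open>With this correction \<open>form (f i) (f j)\<close> becomes half the sum of
    \<open>form (u i) (u j)\<close> and \<open>form (u j) (u i)\<close>, which is 0.\<close>
  define f where "f e = u e + (\<Sum>i\<in>E. smul (form (u i) (u e) / 2) i)" for e
  have EE: "form i j = 0" if "i \<in> E" "j \<in> E" for i j using that E iso by blast
  have ef: "form i (f j) = (if i = j then 1 else 0)" if "i \<in> E" "j \<in> E" for i j
    using that by (simp add: f_def form_add_right form_sum_right form_scale_right u EE)
  have ff: "form (f i) (f j) = 0" if ij: "i \<in> E" "j \<in> E" for i j
  proof -
    have "form (f i) (f j) = form (u i) (f j) + form (u j) (u i) / 2"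
      using ij fin by (simp add: f_def[of i] form_add_left form_sum_left form_scale_left ef sum.delta
          if_distrib[of "\<lambda>z. _ * z"] cong: if_cong)
    also have "form (u i) (f j) = form (u i) (u j) - form (u i) (u j) / 2"
    proof -
      have "form (u i) k = - (if k = i then 1 else 0)" if "k \<in> E" for k
        using u[OF that ij(1)] form_swap[of "u i" k] by simp
      then have "(\<Sum>k\<in>E. form (u k) (u j) / 2 * form (u i) k) = (\<Sum>k\<in>E. if k = i then - (form (u k) (u j) / 2) else 0)"
        by (intro sum.cong) auto
      then show ?thesis
        using ij fin by (simp add: f_def form_add_right form_sum_right form_scale_right)
    qed
    finally show ?thesis using form_swap[of "u j" "u i"] two by (simp add: field_simps)
  qed
  have fe: "form (f j) i = - (if i = j then 1 else 0)" if "i \<in> E" "j \<in> E" for i j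
    using ef[OF that] form_swap[of "f j" i] by simp
  have exp: "w = (\<Sum>e\<in>E. smul (form w (f e)) e) + (\<Sum>e\<in>E. smul (form e w) (f e))" for w
  proof -
    \<comment> \<open>Without its \<open>f\<close> part, the vector is orthogonal to
      \<open>E\<close>, hence to \<open>X\<close>, hence lies in \<open>X\<close> by
      coisotropy.\<close>
    define x where "x = w - (\<Sum>e\<in>E. smul (form e w) (f e))"
    have "form e x = 0" if "e \<in> E" for e
      using that fin by (simp add: x_def form_diff_right form_sum_right form_scale_right ef
          if_distrib[of "\<lambda>z. _ * z"] cong: if_cong)
    then have ex: "\<forall>e\<in>E. form x e = 0" using form_swap[of x] by simp
    have "form x y = 0" if "y \<in> span E" for y
      using that
    proof (induction rule: span_induct)
      case base
      show ?case by (auto simp: subspace_def form_add_right form_scale_right)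
    qed (use ex in blast)
    then have "\<forall>y\<in>X. form y x = 0" using E(3) form_swap[of _ x] by auto
    then have "x \<in> X" by (rule coiso)
    then have "x \<in> span E" using E(3) by blast
    then obtain c where c: "x = (\<Sum>e\<in>E. smul (c e) e)" unfolding span_finite[OF fin] by auto
    have "c e = form w (f e)" if "e \<in> E" for e
    proof -
      have "form x (f e) = c e"
        using that fin by (simp add: c form_sum_left form_scale_left ef
            if_distrib[of "\<lambda>z. _ * z"] cong: if_cong)
      moreover have "form x (f e) = form w (f e)"
        using that by (simp add: x_def form_diff_left form_sum_left form_scale_left ff)
      ultimately show ?thesis by simp
    qed
    then have "x = (\<Sum>e\<in>E. smul (form w (f e)) e)" unfolding c by (intro sum.cong) auto
    then show ?thesis by (simp add: x_def algebra_simps)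
  qed
  have "w \<in> X" if "\<forall>e\<in>E. form e w = 0" for w
  proof -
    have "(\<Sum>e\<in>E. smul (form w (f e)) e) \<in> X"
      by (rule subspace_sum[OF X], rule subspace_scale[OF X]) (use E in blast)
    then show ?thesis using exp[of w] that by simp
  qed
  then have "X = {w. \<forall>e\<in>E. form e w = 0}" using iso E(1) by blast
  then show thesis using that[of E f] fin E(1) ff ef exp by blast
qed

end

section \<open>Dual lattices in a polarised symplectic space\<close>

locale symplectic_basis =
  local_field_character absF p \<psi> + V: symplectic_space smul form
  for absF :: "'f::field \<Rightarrow> real" and p :: nat and \<psi> :: "'f \<Rightarrow> 'r::field"
    and smul :: "'f \<Rightarrow> 'w::ab_group_add \<Rightarrow> 'w" and form :: "'w \<Rightarrow> 'w \<Rightarrow> 'f" +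
  fixes E :: "'w set" and f :: "'w \<Rightarrow> 'w"
  assumes finite_E: "finite E"
    and form_E: "e \<in> E \<Longrightarrow> e' \<in> E \<Longrightarrow> form e e' = 0"
    and form_f: "e \<in> E \<Longrightarrow> e' \<in> E \<Longrightarrow> form (f e) (f e') = 0"
    and form_E_f: "e \<in> E \<Longrightarrow> e' \<in> E \<Longrightarrow> form e (f e') = (if e = e' then 1 else 0)"
    and expansion: "w = (\<Sum>e\<in>E. smul (form w (f e)) e) + (\<Sum>e\<in>E. smul (form e w) (f e))"
begin

definition X :: "'w set" where "X = {w. \<forall>e\<in>E. form e w = 0}"
definition Y :: "'w set" where "Y = {w. \<forall>e\<in>E. form w (f e) = 0}"

text \<open>
  For \<open>s \<noteq> 0\<close> the lattices \<open>LX s\<close> of \<open>X\<close> and \<open>LY s\<close> of \<open>Y\<close> are dual to each other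
  under \<open>\<psi> \<circ> form\<close>.
\<close>

definition LX :: "'f \<Rightarrow> 'w set" where
  "LX s = {x \<in> X. \<forall>e\<in>E. absF (form x (f e)) \<le> absF s}"
definition LY :: "'f \<Rightarrow> 'w set" where
  "LY s = {y \<in> Y. \<forall>e\<in>E. s * form e y \<in> conductor}"

lemma expansion_X: "x \<in> X \<Longrightarrow> x = (\<Sum>e\<in>E. smul (form x (f e)) e)"
  using expansion[of x] by (simp add: X_def)

lemma expansion_Y: "y \<in> Y \<Longrightarrow> y = (\<Sum>e\<in>E. smul (form e y) (f e))"
  using expansion[of y] by (simp add: Y_def)

lemma sum_in_X: "(\<Sum>e\<in>E. smul (c e) e) \<in> X"
  by (simp add: X_def V.form_sum_right V.form_scale_right form_E)

lemma sum_in_Y: "(\<Sum>e\<in>E. smul (c e) (f e)) \<in> Y"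
  by (simp add: Y_def V.form_sum_left V.form_scale_left form_f)

lemma X_coordinate: "e \<in> E \<Longrightarrow> form (\<Sum>e\<in>E. smul (c e) e) (f e) = c e"
  using finite_E by (simp add: V.form_sum_left V.form_scale_left form_E_f
      if_distrib[of "\<lambda>z. _ * z"] cong: if_cong)

lemma Y_coordinate: "e \<in> E \<Longrightarrow> form e (\<Sum>e\<in>E. smul (c e) (f e)) = c e"
  using finite_E by (simp add: V.form_sum_right V.form_scale_right form_E_f
      if_distrib[of "\<lambda>z. _ * z"] cong: if_cong)

lemma decompose: "\<exists>x\<in>X. \<exists>y\<in>Y. w = x + y"

  by (rule bexI[where x = "\<Sum>e\<in>E. smul (form w (f e)) e"], rule bexI[where x = "\<Sum>e\<in>E. smul (form e w) (f e)"])
    (simp_all only: expansion[of w, symmetric] sum_in_X sum_in_Y)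

lemma X_zero: "0 \<in> X" and X_diff: "x \<in> X \<Longrightarrow> x' \<in> X \<Longrightarrow> x - x' \<in> X"
  and X_add: "x \<in> X \<Longrightarrow> x' \<in> X \<Longrightarrow> x + x' \<in> X"
  by (auto simp: X_def V.form_diff_right V.form_add_right)

lemma Y_zero: "0 \<in> Y" and Y_diff: "y \<in> Y \<Longrightarrow> y' \<in> Y \<Longrightarrow> y - y' \<in> Y"
  by (auto simp: Y_def V.form_diff_left)

lemma X_isotropic:
  assumes "x \<in> X" "x' \<in> X"
  shows "form x x' = 0"
proof -
  have "form x x' = form (\<Sum>e\<in>E. smul (form x (f e)) e) x'"
    by (rule arg_cong[OF expansion_X[OF assms(1)], where f = "\<lambda>z. form z x'"])
  also have "\<dots> = 0"
    using assms(2) by (simp add: V.form_sum_left V.form_scale_left X_def)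
  finally show ?thesis .
qed

lemma form_X_Y:
  assumes "y \<in> Y"
  shows "form x y = (\<Sum>e\<in>E. form e y * form x (f e))"
proof -
  have "form x y = form x (\<Sum>e\<in>E. smul (form e y) (f e))"
    by (rule arg_cong[OF expansion_Y[OF assms]])
  then show ?thesis by (simp add: V.form_sum_right V.form_scale_right)
qed

lemma Y_isotropic: "y \<in> Y \<Longrightarrow> y' \<in> Y \<Longrightarrow> form y y' = 0"
  using form_X_Y[of y' y] by (simp add: Y_def)

lemma LX_sub: "LX s \<subseteq> X" and LY_sub: "LY s \<subseteq> Y"
  by (auto simp: LX_def LY_def)

lemma LX_zero: "0 \<in> LX s"
  by (simp add: LX_def X_zero abs_nonneg)

lemma LX_diff: "x \<in> LX s \<Longrightarrow> x' \<in> LX s \<Longrightarrow> x - x' \<in> LX s"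
  by (auto simp: LX_def X_diff V.form_diff_left intro!: order_trans[OF abs_diff_le])

lemma LY_zero: "0 \<in> LY s"
  by (simp add: LY_def Y_zero)

lemma LY_diff: "y \<in> LY s \<Longrightarrow> y' \<in> LY s \<Longrightarrow> y - y' \<in> LY s"
  unfolding LY_def by (auto simp: Y_diff V.form_diff_right right_diff_distrib conductor_diff)

lemma LX_add: "x \<in> LX s \<Longrightarrow> x' \<in> LX s \<Longrightarrow> x + x' \<in> LX s"
  using LX_diff[of x s "0 - x'"] LX_diff[OF LX_zero, of x' s] by simp

lemma LY_add: "y \<in> LY s \<Longrightarrow> y' \<in> LY s \<Longrightarrow> y + y' \<in> LY s"
  using LY_diff[of y s "0 - y'"] LY_diff[OF LY_zero, of y' s] by simp

lemma LX_LY: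
  assumes "s \<noteq> 0" "x \<in> LX s" "y \<in> LY s"
  shows "\<psi> (form x y) = 1"
proof -
  have "\<psi> (form e y * form x (f e)) = 1" if "e \<in> E" for e
  proof -
    have "absF (form x (f e) / s) \<le> 1" "s * form e y \<in> conductor"
      using assms that abs_pos[of s] by (auto simp: LX_def LY_def abs_divide)
    then have "\<psi> (form x (f e) / s * (s * form e y)) = 1" unfolding conductor_def by blast
    then show ?thesis using assms(1) by (simp add: mult.commute)
  qed
  then show ?thesis using form_X_Y[of y x] assms(3) LY_sub psi_sum by (metis (no_types, lifting) subsetD)
qed

text \<open>Testing against multiples of a single \<open>f e\<close> reduces this to
  \<open>conductor_dual\<close>. The other direction, \<open>LY_dual\<close>, comes in the same way
  straight from the definition of the conductor.\<close>

lemma LX_dual: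
  assumes "s \<noteq> 0" "x \<in> X" "\<And>y. y \<in> LY s \<Longrightarrow> \<psi> (form x y) = 1"
  shows "x \<in> LX s"
proof -
  have "absF (form x (f e)) \<le> absF s" if e: "e \<in> E" for e
  proof -
    have "\<psi> (form x (f e) / s * k) = 1" if k: "k \<in> conductor" for k
    proof -
      have "smul (k / s) (f e) \<in> LY s"
        using e k assms(1) by (auto simp: LY_def Y_def V.form_scale_left V.form_scale_right form_f form_E_f)
      from assms(3)[OF this] show ?thesis by (simp add: V.form_scale_right mult.commute)
    qed
    then have "absF (form x (f e) / s) \<le> 1" by (rule conductor_dual)
    then show ?thesis using assms(1) abs_pos[of s] by (simp add: abs_divide)
  qed
  then show ?thesis using assms(2) by (simp add: LX_def)
qed

lemma LY_dual:
  assumes "y \<in> Y" "\<And>x. x \<in> LX s \<Longrightarrow> \<psi> (form x y) = 1"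
  shows "y \<in> LY s"
proof -
  have "\<psi> (a * (s * form e y)) = 1" if e: "e \<in> E" and a: "absF a \<le> 1" for e a
  proof -
    have "smul (a * s) e \<in> LX s"
      using e mult_right_mono[OF a abs_nonneg[of s]] abs_nonneg[of s]
      by (auto simp: LX_def X_def V.form_scale_left V.form_scale_right form_E form_E_f abs_mult)
    from assms(2)[OF this] show ?thesis by (simp add: V.form_scale_left mult.assoc)
  qed
  then show ?thesis using assms(1) by (simp add: LY_def conductor_def)
qed

lemma LX_transversal:
  assumes "s' \<noteq> 0"
  obtains T where "finite T" "T \<subseteq> LX s" "\<And>x. x \<in> LX s \<Longrightarrow> \<exists>!t. t \<in> T \<and> x - t \<in> LX s'"
proof -
  obtain T1 where T1: "finite T1" "\<And>a. absF a \<le> absF s \<Longrightarrow> \<exists>t\<in>T1. absF (a - t) < absF s'"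
    using bounded_finite_cover[OF abs_pos[OF assms]] by metis
  let ?T = "(\<lambda>c. \<Sum>e\<in>E. smul (c e) e) ` PiE E (\<lambda>_. T1)"
  have "\<exists>t\<in>?T. x - t \<in> LX s'" if x: "x \<in> LX s" for x
  proof -
    have "\<forall>e\<in>E. \<exists>t\<in>T1. absF (form x (f e) - t) < absF s'" using x T1(2) by (simp add: LX_def)
    then obtain c where c: "\<And>e. e \<in> E \<Longrightarrow> c e \<in> T1 \<and> absF (form x (f e) - c e) < absF s'" by metis
    have "restrict c E \<in> PiE E (\<lambda>_. T1)" using c by simp
    moreover have "x - (\<Sum>e\<in>E. smul (restrict c E e) e) \<in> LX s'"
      using x c sum_in_X by (force simp: LX_def X_diff V.form_diff_left X_coordinate)
    ultimately show ?thesis by blast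
  qed
  moreover have "finite ?T" using T1(1) finite_E by (simp add: finite_PiE)
  ultimately obtain T where "finite T" "T \<subseteq> LX s" "\<And>x. x \<in> LX s \<Longrightarrow> \<exists>!t. t \<in> T \<and> x - t \<in> LX s'"
    using finite_transversal[of ?T "LX s" "LX s'", OF _ _ LX_zero LX_diff] by blast
  then show thesis by (rule that)
qed

lemma LY_transversal:
  assumes "s \<noteq> 0" "s' \<noteq> 0"
  obtains T where "finite T" "T \<subseteq> LY s" "\<And>y. y \<in> LY s \<Longrightarrow> \<exists>!t. t \<in> T \<and> y - t \<in> LY s'"
proof -
  obtain r where r: "r > 0" "\<And>c. c \<in> conductor \<Longrightarrow> absF c < r" using conductor_bounded by blast
  obtain \<epsilon> where \<epsilon>: "\<epsilon> > 0" "\<And>c. absF c < \<epsilon> \<Longrightarrow> c \<in> conductor" using conductor_open by blast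
  \<comment> \<open>Coordinates on \<open>LY s\<close> are at most r / absF s because the conductor
    is bounded; errors below \<epsilon> / absF s' stay in \<open>LY s'\<close> because the conductor
    contains a ball.\<close>
  have "\<epsilon> / absF s' > 0" using \<epsilon>(1) abs_pos[OF assms(2)] by simp
  then obtain T1 where T1: "finite T1" "\<And>a. absF a \<le> r / absF s \<Longrightarrow> \<exists>t\<in>T1. absF (a - t) < \<epsilon> / absF s'"
    using bounded_finite_cover by metis
  let ?T = "(\<lambda>c. \<Sum>e\<in>E. smul (c e) (f e)) ` PiE E (\<lambda>_. T1)"
  have "\<exists>t\<in>?T. y - t \<in> LY s'" if y: "y \<in> LY s" for y
  proof -
    have "absF (form e y) \<le> r / absF s" if "e \<in> E" for e
      using r(2)[of "s * form e y"] y that abs_pos[OF assms(1)]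
      by (simp add: LY_def abs_mult field_simps)
    then have "\<forall>e\<in>E. \<exists>t\<in>T1. absF (form e y - t) < \<epsilon> / absF s'" using T1(2) by blast
    then obtain c where c: "\<And>e. e \<in> E \<Longrightarrow> c e \<in> T1 \<and> absF (form e y - c e) < \<epsilon> / absF s'" by metis
    have "restrict c E \<in> PiE E (\<lambda>_. T1)" using c by simp
    moreover have "s' * (form e y - c e) \<in> conductor" if "e \<in> E" for e
      by (rule \<epsilon>(2)) (use c[OF that] abs_pos[OF assms(2)] in \<open>simp add: abs_mult pos_less_divide_eq mult.commute\<close>)
    then have "y - (\<Sum>e\<in>E. smul (restrict c E e) (f e)) \<in> LY s'"
      using y sum_in_Y by (force simp: LY_def Y_diff V.form_diff_right Y_coordinate)
    ultimately show ?thesis by blast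
  qed
  moreover have "finite ?T" using T1(1) finite_E by (simp add: finite_PiE)
  ultimately obtain T where "finite T" "T \<subseteq> LY s" "\<And>x. x \<in> LY s \<Longrightarrow> \<exists>!t. t \<in> T \<and> x - t \<in> LY s'"
    using finite_transversal[of ?T "LY s" "LY s'", OF _ _ LY_zero LY_diff] by blast
  then show thesis by (rule that)
qed

lemma LX_small:
  assumes "openin (vs_topology absF smul) U" "0 \<in> U"
  obtains s where "s \<noteq> 0" "LX s \<subseteq> U"
proof -
  obtain \<epsilon> where \<epsilon>: "\<epsilon> > 0" "\<And>c. \<forall>e\<in>E. absF (c e) < \<epsilon> \<Longrightarrow> 0 + (\<Sum>e\<in>E. smul (c e) e) \<in> U"
    using assms finite_E unfolding openin_vs_topology by meson
  obtain s where s: "s \<noteq> 0" "absF s < \<epsilon>" using exists_abs_less[OF \<epsilon>(1)] by blast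
  have "x \<in> U" if x: "x \<in> LX s" for x
    using \<epsilon>(2)[of "\<lambda>e. form x (f e)"] x s(2) expansion_X[of x] by (force simp: LX_def)
  then show thesis using that s(1) by blast
qed

lemma LY_small:
  assumes "openin (vs_topology absF smul) U" "0 \<in> U" "s0 \<noteq> 0"
  obtains s where "s \<noteq> 0" "LY s \<subseteq> U" "LY s \<subseteq> LY s0"
proof -
  obtain r where r: "r > 0" "\<And>c. c \<in> conductor \<Longrightarrow> absF c < r" using conductor_bounded by blast
  have "finite (f ` E)" using finite_E by simp
  then obtain \<epsilon> where \<epsilon>: "\<epsilon> > 0" "\<And>c. \<forall>b\<in>f ` E. absF (c b) < \<epsilon> \<Longrightarrow> 0 + (\<Sum>b\<in>f ` E. smul (c b) b) \<in> U"
    using assms unfolding openin_vs_topology by meson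
  \<comment> \<open>\<open>LY s\<close> shrinks as \<open>s\<close> grows, contrary to
    \<open>LX s\<close>. The bound r / \<epsilon> makes the coordinates smaller than \<epsilon>, the
    bound absF s0 gives the inclusion in \<open>LY s0\<close>.\<close>
  obtain s where s: "s \<noteq> 0" "max (r / \<epsilon>) (absF s0) < absF s" using exists_abs_greater by blast
  \<comment> \<open>Neighbourhoods are described by coefficients attached to vectors, so coordinates
    indexed by \<open>E\<close> must be carried over to the image of \<open>f\<close>.\<close>
  have inj: "inj_on f E"
  proof (rule inj_onI)
    fix e e' assume "e \<in> E" "e' \<in> E" "f e = f e'"
    then show "e = e'" using form_E_f[of e e] form_E_f[of e e'] by (auto split: if_splits)
  qed
  have "y \<in> U" if y: "y \<in> LY s" for y
  proof -
    have "absF (form e y) < \<epsilon>" if e: "e \<in> E" for e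
    proof -
      have "absF s * absF (form e y) < r" using r(2) y e by (auto simp: LY_def abs_mult[symmetric])
      also have "r < absF s * \<epsilon>" using s(2) \<epsilon>(1) by (simp add: field_simps)
      finally show ?thesis using abs_pos[OF s(1)] by simp
    qed
    then have "0 + (\<Sum>b\<in>f ` E. smul (form (the_inv_into E f b) y) b) \<in> U"
      by (intro \<epsilon>(2)) (auto simp: the_inv_into_f_f[OF inj])
    also have "(\<Sum>b\<in>f ` E. smul (form (the_inv_into E f b) y) b) = (\<Sum>e\<in>E. smul (form e y) (f e))"
      by (simp add: sum.reindex[OF inj] the_inv_into_f_f[OF inj])
    finally show ?thesis using expansion_Y[of y] y LY_sub[of s] by auto
  qed
  moreover have "y \<in> LY s0" if y: "y \<in> LY s" for y
  proof -
    have "absF (s0 / s) \<le> 1" using s abs_pos[OF s(1)] by (simp add: abs_divide)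
    then have "s0 / s * (s * form e y) \<in> conductor" if "e \<in> E" for e
      using that y conductor_scale[of "s0 / s" "s * form e y"] unfolding LY_def by blast
    then show ?thesis using y s(1) by (simp add: LY_def)
  qed
  ultimately show thesis using that s(1) by blast
qed

end

section \<open>The Schroedinger model\<close>

locale heisenberg_polarization =
  symplectic_basis absF p \<psi> smul form E f + S: heisenberg_rep smulS absF smul form \<psi> \<rho>
  for absF :: "'f::field \<Rightarrow> real" and p :: nat and \<psi> :: "'f \<Rightarrow> 'r::field"
    and smul :: "'f \<Rightarrow> 'w::ab_group_add \<Rightarrow> 'w" and form :: "'w \<Rightarrow> 'w \<Rightarrow> 'f"
    and E :: "'w set" and f :: "'w \<Rightarrow> 'w"
    and smulS :: "'r \<Rightarrow> 's::ab_group_add \<Rightarrow> 's" and \<rho> :: "'w \<times> 'f \<Rightarrow> 's \<Rightarrow> 's" +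
  assumes two: "(2::'f) \<noteq> 0"
begin

text \<open>A projective representation of \<open>W\<close> whose cocycle is \<psi> of half the
  form; on the isotropic subspaces \<open>X\<close> and \<open>Y\<close> it is a genuine
  action.\<close>

definition \<tau> :: "'w \<Rightarrow> 's \<Rightarrow> 's" where "\<tau> w = \<rho> (w, 0)"

lemma rho_linear: "Vector_Spaces.linear smulS smulS (\<rho> h)"
  using S.hom by (auto simp: hom_def GL_def heisenberg_def)

lemma rho_mult: "\<rho> (w, t) (\<rho> (w', t') v) = \<rho> (w + w', t + t' + form w w' / 2) v"
  using S.hom by (auto simp: hom_def GL_def heisenberg_def fun_eq_iff)

lemma rho_tau: "\<rho> (w, t) v = smulS (\<psi> t) (\<tau> w v)"
  using rho_mult[of 0 t w 0 v] by (simp add: \<tau>_def S.central_character)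

lemma tau_zero [simp]: "\<tau> 0 v = v"
  by (simp add: \<tau>_def S.central_character)

lemma tau_tau: "\<tau> w (\<tau> w' v) = smulS (\<psi> (form w w' / 2)) (\<tau> (w + w') v)"
  using rho_mult[of w 0 w' 0 v] by (simp add: \<tau>_def[symmetric] rho_tau)

lemma tau_add: "\<tau> (w + w') v = smulS (\<psi> (- (form w w' / 2))) (\<tau> w (\<tau> w' v))"
  by (simp add: tau_tau)

lemma tau_commute: "\<tau> w (\<tau> w' v) = smulS (\<psi> (form w w')) (\<tau> w' (\<tau> w v))"
proof -
  have "form w w' / 2 = form w w' + form w' w / 2"
    using V.form_swap[of w' w] two by (simp add: field_simps)
  then have "\<psi> (form w w' / 2) = \<psi> (form w w') * \<psi> (form w' w / 2)" by (metis psi_add)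
  then show ?thesis by (simp add: tau_tau add.commute)
qed

lemma tau_linear: "Vector_Spaces.linear smulS smulS (\<tau> w)"
  unfolding \<tau>_def by (rule rho_linear)

lemma tau_plus: "\<tau> w (v + v') = \<tau> w v + \<tau> w v'"
  and tau_scale: "\<tau> w (smulS c v) = smulS c (\<tau> w v)"
  and tau_sum: "\<tau> w (\<Sum>i\<in>I. g i) = (\<Sum>i\<in>I. \<tau> w (g i))"
  and tau_zero_right [simp]: "\<tau> w 0 = 0"
proof -
  interpret l: Vector_Spaces.linear smulS smulS "\<tau> w" by (rule tau_linear)
  show "\<tau> w (v + v') = \<tau> w v + \<tau> w v'" "\<tau> w (smulS c v) = smulS c (\<tau> w v)"
    "\<tau> w (\<Sum>i\<in>I. g i) = (\<Sum>i\<in>I. \<tau> w (g i))" "\<tau> w 0 = 0"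
    by (simp_all add: l.add l.scale l.sum l.zero)
qed

lemma tau_nonzero: "v \<noteq> 0 \<Longrightarrow> \<tau> w v \<noteq> 0"
  using tau_tau[of "- w" w v] V.form_alternating[of w] by (force simp: V.form_minus_left)

lemma tau_X: "x \<in> X \<Longrightarrow> x' \<in> X \<Longrightarrow> \<tau> x (\<tau> x' v) = \<tau> (x + x') v"
  by (simp add: tau_tau X_isotropic)

lemma tau_Y: "y \<in> Y \<Longrightarrow> y' \<in> Y \<Longrightarrow> \<tau> y (\<tau> y' v) = \<tau> (y + y') v"
  by (simp add: tau_tau Y_isotropic)

lemma stabilizer_open:
  obtains U where "openin (vs_topology absF smul) U" "0 \<in> U" "\<And>u. u \<in> U \<Longrightarrow> \<tau> u v = v"
proof -
  have "(0, 0) \<in> {h. \<rho> h v = v}" using tau_zero by (simp add: \<tau>_def)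
  then obtain U V where U: "openin (vs_topology absF smul) U" "0 \<in> U" and V: "0 \<in> V"
    and UV: "U \<times> V \<subseteq> {h. \<rho> h v = v}"
    using S.smooth[of v] unfolding openin_prod_topology_alt by meson
  have "\<tau> u v = v" if "u \<in> U" for u
  proof -
    have "(u, 0) \<in> U \<times> V" using that V by simp
    then show ?thesis using UV by (auto simp: \<tau>_def)
  qed
  with U show thesis by (rule that)
qed

text \<open>Duality applied to \<open>x - x'\<close>. This and \<open>LY_sep\<close> provide the
  separation of cosets that both \<open>delta_function\<close> and
  \<open>independent_eigenvectors\<close> ask for.\<close>

lemma LX_sep:
  assumes "s \<noteq> 0" "x \<in> X" "x' \<in> X" "x - x' \<notin> LX s"
  shows "\<exists>y\<in>LY s. \<psi> (form x y) \<noteq> \<psi> (form x' y)"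
proof -
  obtain y where y: "y \<in> LY s" "\<psi> (form (x - x') y) \<noteq> 1"
    using LX_dual[OF assms(1) X_diff[OF assms(2,3)]] assms(4) by blast
  have "\<psi> (form x y) = \<psi> (form (x - x') y) * \<psi> (form x' y)"
    by (simp add: V.form_diff_left flip: psi_add)
  then have "\<psi> (form x y) \<noteq> \<psi> (form x' y)" using y(2) by simp
  then show ?thesis using y(1) by blast
qed

lemma LY_sep:
  assumes "y \<in> Y" "y' \<in> Y" "y - y' \<notin> LY s"
  shows "\<exists>x\<in>LX s. \<psi> (form x y) \<noteq> \<psi> (form x y')"
proof -
  obtain x where x: "x \<in> LX s" "\<psi> (form x (y - y')) \<noteq> 1"
    using LY_dual[OF Y_diff[OF assms(1,2)]] assms(3) by blast
  have "\<psi> (form x y) = \<psi> (form x (y - y')) * \<psi> (form x y')"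
    by (simp add: V.form_diff_right flip: psi_add)
  then have "\<psi> (form x y) \<noteq> \<psi> (form x y')" using x(2) by simp
  then show ?thesis using x(1) by blast
qed

lemma psi_form_swap: "\<psi> (form w w') = inverse (\<psi> (form w' w))"
  using V.form_swap[of w w'] by (simp add: psi_minus)

text \<open>Smoothness gives a vector fixed by some \<open>LX s'\<close> and some
  \<open>LY s\<close>, but with unrelated parameters. Projecting to an eigenspace of the larger
  group \<open>LX s\<close> dual to \<open>LY s\<close> keeps the invariance under
  \<open>LY s\<close>, and a translation from \<open>Y\<close> then makes the eigencharacter
  trivial.\<close>

lemma exists_lattice_fixed_vector:
  obtains s v0 where "s \<noteq> 0" "v0 \<noteq> 0" "\<And>a. a \<in> LX s \<Longrightarrow> \<tau> a v0 = v0"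
    "\<And>b. b \<in> LY s \<Longrightarrow> \<tau> b v0 = v0"
proof -
  obtain v :: 's where v: "v \<noteq> 0" using S.nonzero ..
  obtain U where U: "openin (vs_topology absF smul) U" "0 \<in> U" "\<And>u. u \<in> U \<Longrightarrow> \<tau> u v = v"
    by (rule stabilizer_open[of v], rule that)
  obtain s where s: "s \<noteq> 0" "LY s \<subseteq> U" "LY s \<subseteq> LY 1"
    by (rule LY_small[OF U(1,2) one_neq_zero], rule that)
  obtain s' where s': "s' \<noteq> 0" "LX s' \<subseteq> U" by (rule LX_small[OF U(1,2)], rule that)
  obtain T where T: "finite T" "T \<subseteq> LX s" "\<And>x. x \<in> LX s \<Longrightarrow> \<exists>!t. t \<in> T \<and> x - t \<in> LX s'"
    by (rule LX_transversal[OF s'(1)], rule that)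
  have TX: "t \<in> X" if "t \<in> T" for t using that T(2) LX_sub by blast
  \<comment> \<open>The unnormalised projection of \<open>v\<close> to the vectors on which each
    \<open>a\<close> in \<open>LX s\<close> acts by \<psi> (- form a y). For \<open>y\<close> in
    \<open>LY s'\<close> its terms depend only on classes modulo \<open>LX s'\<close>.\<close>
  define P where "P y = (\<Sum>t\<in>T. smulS (\<psi> (form t y)) (\<tau> t v))" for y
  have ex: "\<exists>y\<in>LY s'. P y \<noteq> 0"
  proof (rule ccontr)
    assume neg: "\<not> ?thesis"
    \<comment> \<open>If every projection vanished, the constant 1 would lie in this space of
      coefficient functions, which is stable under the characters given by \<open>LY s'\<close>.
      Interpolation then puts a function concentrated at \<open>t0\<close> into it, and this says
      that \<tau> t0 v = 0.\<close>
    define C where "C = {g. \<forall>y\<in>LY s'. (\<Sum>t\<in>T. smulS (g t * \<psi> (form t y)) (\<tau> t v)) = 0}"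
    obtain t0 where t0: "t0 \<in> T" "0 - t0 \<in> LX s'" using T(3)[OF LX_zero] by blast
    have "\<exists>g\<in>C. g t0 = 1 \<and> (\<forall>t\<in>T - {t0}. g t = 0)"
    proof (rule delta_function[where \<theta> = "\<lambda>y t. \<psi> (form t y)" and Z = "LY s'" and h = "\<lambda>_. 1"])
      show "(\<lambda>_. 1) \<in> C" using neg by (auto simp: C_def P_def)
      show "(\<lambda>t. g t + g' t) \<in> C" if "g \<in> C" "g' \<in> C" for g g'
        using that by (auto simp: C_def distrib_right S.scale_left_distrib sum.distrib)
      show "(\<lambda>t. a * g t) \<in> C" if g: "g \<in> C" for g a
      proof -
        have "(\<Sum>t\<in>T. smulS (a * g t * \<psi> (form t y)) (\<tau> t v)) =
            smulS a (\<Sum>t\<in>T. smulS (g t * \<psi> (form t y)) (\<tau> t v))" for y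
          by (simp add: S.scale_sum_right mult.assoc)
        then show ?thesis using g by (simp add: C_def)
      qed
      show "(\<lambda>t. \<psi> (form t z) * g t) \<in> C" if g: "g \<in> C" and z: "z \<in> LY s'" for g z
      proof -
        have "(\<Sum>t\<in>T. smulS (\<psi> (form t z) * g t * \<psi> (form t y)) (\<tau> t v)) = 0" if y: "y \<in> LY s'" for y
        proof -
          have "(\<Sum>t\<in>T. smulS (g t * \<psi> (form t (z + y))) (\<tau> t v)) = 0"
            using g LY_add[OF z y] by (simp add: C_def)
          then show ?thesis by (simp add: V.form_add_right psi_add mult.assoc mult.left_commute)
        qed
        then show ?thesis by (simp add: C_def)
      qed
      show "\<exists>z\<in>LY s'. \<psi> (form t z) \<noteq> \<psi> (form t0 z)" if t: "t \<in> T" "t \<noteq> t0" for t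
      proof (rule LX_sep[OF s'(1) TX[OF t(1)] TX[OF t0(1)]])
        have "t - t \<in> LX s'" by (simp add: LX_zero)
        then show "t - t0 \<notin> LX s'" using T(3)[of t] T(2) t t0(1) by blast
      qed
    qed (rule T(1))
    then obtain g where g: "g \<in> C" "g t0 = 1" "\<forall>t\<in>T - {t0}. g t = 0" by blast
    have "(\<Sum>t\<in>T. smulS (g t * \<psi> (form t 0)) (\<tau> t v)) = (\<Sum>t\<in>T. if t = t0 then \<tau> t v else 0)"
      by (rule sum.cong) (use g in auto)
    moreover have "(\<Sum>t\<in>T. smulS (g t * \<psi> (form t 0)) (\<tau> t v)) = 0"
      using g(1) LY_zero[of s'] unfolding C_def by blast
    ultimately have "\<tau> t0 v = 0" using T(1) t0(1) by simp
    then show False using tau_nonzero v by blast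
  qed
  obtain y where y: "y \<in> LY s'" "P y \<noteq> 0" using ex by blast
  have yY: "y \<in> Y" using y LY_sub by blast
  \<comment> \<open>Commuting \<tau> a past \<tau> y produces exactly the inverse of the eigenvalue
    of \<tau> a on \<open>P y\<close>.\<close>
  have "\<tau> a (\<tau> y (P y)) = \<tau> y (P y)" if a: "a \<in> LX s" for a
  proof -
    have aX: "a \<in> X" using a LX_sub by blast
    have "(\<Sum>t\<in>T. smulS (\<psi> (form (a + t) y)) (\<tau> (a + t) v)) = P y"
      unfolding P_def
    proof (rule transversal_reindex[OF T(1,2,3)])
      fix x x' assume x: "x \<in> LX s" "x' \<in> LX s" "x - x' \<in> LX s'"
      have "\<psi> (form x y) = \<psi> (form (x - x') y) * \<psi> (form x' y)"
        by (simp add: V.form_diff_left flip: psi_add)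
      then have 1: "\<psi> (form x y) = \<psi> (form x' y)" using LX_LY[OF s'(1) x(3) y(1)] by simp
      have "\<tau> x v = \<tau> x' (\<tau> (x - x') v)" using x LX_sub by (subst tau_X) auto
      then have "\<tau> x v = \<tau> x' v" using U(3) x(3) s'(2) by auto
      with 1 show "smulS (\<psi> (form x y)) (\<tau> x v) = smulS (\<psi> (form x' y)) (\<tau> x' v)" by simp
    qed (use a LX_add LX_zero LX_diff in auto)
    moreover have "\<tau> a (\<tau> t v) = \<tau> (a + t) v" if "t \<in> T" for t
      using tau_X[OF aX TX[OF that]] .
    ultimately have "smulS (\<psi> (form a y)) (\<tau> a (P y)) = P y"
      by (simp add: P_def tau_sum tau_scale S.scale_sum_right V.form_add_left psi_add)
    then show ?thesis
      by (subst tau_commute) (simp flip: tau_scale)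
  qed
  moreover have "\<tau> b (\<tau> y (P y)) = \<tau> y (P y)" if b: "b \<in> LY s" for b
  proof -
    have bY: "b \<in> Y" using b LY_sub by blast
    have "\<tau> b (\<tau> t v) = \<tau> t v" if t: "t \<in> T" for t
    proof -
      have "\<psi> (form b t) = 1"
        using LX_LY[OF s(1) _ b, of t] t T(2) psi_form_swap[of b t] by auto
      then show ?thesis using U(3) s(2) b by (subst tau_commute) auto
    qed
    then have "\<tau> b (P y) = P y" by (simp add: P_def tau_sum tau_scale)
    then show ?thesis by (subst tau_commute) (simp add: Y_isotropic[OF bY yY])
  qed
  ultimately show thesis by (rule that[OF s(1) tau_nonzero[OF y(2)]])
qed

lemma span_translates:
  assumes "v0 \<noteq> 0"
  shows "S.span (range (\<lambda>w. \<tau> w v0)) = UNIV"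
proof -
  let ?V = "S.span (range (\<lambda>w. \<tau> w v0))"
  have "\<rho> h v \<in> ?V" if "v \<in> ?V" for h v
  proof -
    interpret l: Vector_Spaces.linear smulS smulS "\<rho> h" by (rule rho_linear)
    obtain w t where h: "h = (w, t)" by (cases h)
    have "\<rho> h (\<tau> w' v0) \<in> ?V" for w'
      by (simp add: h rho_tau tau_tau S.span_base S.span_scale)
    then have "\<rho> h ` range (\<lambda>w. \<tau> w v0) \<subseteq> ?V" by blast
    then have "S.span (\<rho> h ` range (\<lambda>w. \<tau> w v0)) \<subseteq> ?V" by (rule S.span_minimal) (rule S.subspace_span)
    then show ?thesis using that l.span_image[of "range (\<lambda>w. \<tau> w v0)"] by blast
  qed
  then have "?V = {0} \<or> ?V = UNIV" by (intro S.irreducible S.subspace_span) auto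
  moreover have "\<tau> 0 v0 \<in> ?V" by (rule S.span_base) blast
  ultimately show ?thesis using assms by auto
qed

text \<open>Independence of the eigenvectors \<open>u i\<close> allows \<xi> to be prescribed on
  them by a rule that ignores the component in \<open>X\<close>. Invariance is then checked on the
  translates of \<open>v0\<close>, which suffices by \<open>span_translates\<close>.\<close>

lemma exists_X_invariant_functional:
  assumes s: "s \<noteq> 0" and v0: "v0 \<noteq> 0"
    and fixX: "\<And>a. a \<in> LX s \<Longrightarrow> \<tau> a v0 = v0" and fixY: "\<And>b. b \<in> LY s \<Longrightarrow> \<tau> b v0 = v0"
  obtains \<xi> where "Vector_Spaces.linear smulS (*) \<xi>" "\<And>x v. x \<in> X \<Longrightarrow> \<xi> (\<tau> x v) = \<xi> v"
    "\<And>y. y \<in> Y \<Longrightarrow> \<xi> (\<tau> y v0) = (if y \<in> LY s then 1 else 0)"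
proof -
  obtain rx where rx: "\<And>x. x - rx x \<in> LX s" "\<And>x x'. x - x' \<in> LX s \<Longrightarrow> rx x = rx x'"
    using coset_representatives[OF LX_zero LX_diff] by metis
  obtain ry where ry: "\<And>y. y - ry y \<in> LY s" "\<And>y y'. y - y' \<in> LY s \<Longrightarrow> ry y = ry y'"
    using coset_representatives[OF LY_zero LY_diff] by metis
  have rxX: "rx x \<in> X" if "x \<in> X" for x
    using X_diff[OF that subsetD[OF LX_sub rx(1)[of x]]] by simp
  have ryY: "ry y \<in> Y" if "y \<in> Y" for y
    using Y_diff[OF that subsetD[OF LY_sub ry(1)[of y]]] by simp
  define I where "I = rx ` X \<times> ry ` Y"
  define u where "u i = \<tau> (fst i) (\<tau> (snd i) v0)" for i
  have IX: "fst i \<in> X" and IY: "snd i \<in> Y" if "i \<in> I" for i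
    using that rxX ryY by (auto simp: I_def)
  have unz: "u i \<noteq> 0" for i unfolding u_def using tau_nonzero v0 by blast
  have eigX: "\<tau> a (u i) = smulS (\<psi> (form a (snd i))) (u i)" if "a \<in> LX s" "i \<in> I" for a i
  proof -
    have "a \<in> X" using that LX_sub by blast
    then have "\<tau> a (u i) = \<tau> (fst i) (\<tau> a (\<tau> (snd i) v0))"
      unfolding u_def by (subst tau_commute) (simp add: X_isotropic IX[OF that(2)])
    also have "\<dots> = smulS (\<psi> (form a (snd i))) (u i)"
      by (subst tau_commute[of a]) (simp add: fixX[OF that(1)] tau_scale u_def)
    finally show ?thesis .
  qed
  have eigY: "\<tau> b (u i) = smulS (\<psi> (form b (fst i))) (u i)" if "b \<in> LY s" "i \<in> I" for b i
  proof -
    have "b \<in> Y" using that LY_sub by blast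
    then have "\<tau> b (\<tau> (snd i) v0) = \<tau> (snd i) (\<tau> b v0)"
      by (subst tau_commute) (simp add: Y_isotropic IY[OF that(2)])
    then show ?thesis
      unfolding u_def by (subst tau_commute[of b]) (simp add: fixY[OF that(1)])
  qed
  \<comment> \<open>Indices with different components in \<open>X\<close> are told apart by
    \<open>LY s\<close>, the others by \<open>LX s\<close>.\<close>
  have sep: "\<exists>a\<in>LX s \<union> LY s. \<exists>c c'. \<tau> a (u i) = smulS c (u i) \<and> \<tau> a (u j) = smulS c' (u j) \<and> c \<noteq> c'"
    if ij: "i \<in> I" "j \<in> I" "i \<noteq> j" for i j
  proof (cases "fst i = fst j")
    case False
    have "fst i - fst j \<notin> LX s"
    proof
      assume "fst i - fst j \<in> LX s"
      then have "rx (fst i) = rx (fst j)" by (rule rx(2))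
      moreover have "rx (rx x) = rx x" for x using rx(2)[OF rx(1)[of x]] by simp
      ultimately show False using False ij by (auto simp: I_def)
    qed
    then obtain y where y: "y \<in> LY s" "\<psi> (form (fst i) y) \<noteq> \<psi> (form (fst j) y)"
      using LX_sep[OF s IX[OF ij(1)] IX[OF ij(2)]] by blast
    then have "\<psi> (form y (fst i)) \<noteq> \<psi> (form y (fst j))"
      using psi_form_swap[of y] by simp
    then show ?thesis using y eigY ij by blast
  next
    case True
    then have ne: "snd i \<noteq> snd j" using ij by (auto simp: prod_eq_iff)
    have "snd i - snd j \<notin> LY s"
    proof
      assume "snd i - snd j \<in> LY s"
      then have "ry (snd i) = ry (snd j)" by (rule ry(2))
      moreover have "ry (ry x) = ry x" for x using ry(2)[OF ry(1)[of x]] by simp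
      ultimately show False using ne ij by (auto simp: I_def)
    qed
    then obtain x where "x \<in> LX s" "\<psi> (form x (snd i)) \<noteq> \<psi> (form x (snd j))"
      using LY_sep[OF IY[OF ij(1)] IY[OF ij(2)]] by blast
    then show ?thesis using eigX ij by blast
  qed
  have inj: "inj_on u I"
  proof (rule inj_onI, rule ccontr)
    fix i j assume ij: "i \<in> I" "j \<in> I" "u i = u j" "i \<noteq> j"
    then show False using sep[OF ij(1,2,4)] unz[of j] S.scale_right_imp_eq by metis
  qed
  have "S.independent (u ` I)"
  proof (rule S.independent_eigenvectors[where A = "LX s \<union> LY s" and T = \<tau>])
    show "\<exists>c. \<tau> a b = smulS c b" if "a \<in> LX s \<union> LY s" "b \<in> u ` I" for a b
      using that eigX eigY by blast
    show "\<exists>a\<in>LX s \<union> LY s. \<exists>c c'. \<tau> a b = smulS c b \<and> \<tau> a b' = smulS c' b' \<and> c \<noteq> c'"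
      if b: "b \<in> u ` I" "b' \<in> u ` I" "b \<noteq> b'" for b b'
    proof -
      obtain i j where "i \<in> I" "j \<in> I" "b = u i" "b' = u j" using b by blast
      then show ?thesis using sep[of i j] b(3) by auto
    qed
    show "0 \<notin> u ` I" using unz by (metis imageE)
  qed (rule tau_linear)
  interpret vector_space_pair smulS "(*) :: 'r \<Rightarrow> 'r \<Rightarrow> 'r"
    by unfold_locales (simp_all add: algebra_simps)
  obtain \<xi> where lam: "Vector_Spaces.linear smulS (*) \<xi>"
    "\<forall>b\<in>u ` I. \<xi> b = (if snd (the_inv_into I u b) \<in> LY s then 1 else (0::'r))"
    using linear_independent_extend[OF \<open>S.independent (u ` I)\<close>,
        of "\<lambda>b. if snd (the_inv_into I u b) \<in> LY s then 1 else 0"] by blast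
  interpret l: Vector_Spaces.linear smulS "(*)" \<xi> by (rule lam(1))
  have lam_u: "\<xi> (u i) = (if snd i \<in> LY s then 1 else 0)" if "i \<in> I" for i
    using lam(2) that by (simp add: the_inv_into_f_f[OF inj])
  have val: "\<xi> (\<tau> x (\<tau> y v0)) = (if y \<in> LY s then 1 else 0)" if x: "x \<in> X" and y: "y \<in> Y" for x y
  proof -
    define a b where "a = x - rx x" and "b = y - ry y"
    have a: "a \<in> LX s" "a \<in> X" and b: "b \<in> LY s" "b \<in> Y"
      using rx(1) ry(1) LX_sub LY_sub unfolding a_def b_def by blast+
    have "\<tau> y v0 = \<tau> (ry y) (\<tau> b v0)" using tau_Y[OF ryY[OF y] b(2)] by (simp add: b_def)
    then have "\<tau> x (\<tau> y v0) = \<tau> (rx x) (\<tau> a (\<tau> (ry y) v0))"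
      using tau_X[OF rxX[OF x] a(2)] fixY[OF b(1)] by (simp add: a_def)
    also have "\<dots> = smulS (\<psi> (form a (ry y))) (\<tau> (rx x) (\<tau> (ry y) v0))"
      by (subst tau_commute[of a]) (simp add: fixX[OF a(1)] tau_scale)
    \<comment> \<open>The factor \<psi> (form a (ry y)) can differ from 1 only when
      \<open>ry y\<close> lies outside \<open>LY s\<close>, and there \<xi> vanishes.\<close>
    finally have "\<xi> (\<tau> x (\<tau> y v0)) = \<psi> (form a (ry y)) * \<xi> (u (rx x, ry y))"
      by (simp add: l.scale u_def)
    also have "\<xi> (u (rx x, ry y)) = (if ry y \<in> LY s then 1 else 0)"
      using x y by (subst lam_u) (auto simp: I_def)
    also have "ry y \<in> LY s \<longleftrightarrow> y \<in> LY s"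
      using LY_diff[OF _ b(1), of y] LY_add[OF _ b(1), of "ry y"] by (auto simp: b_def)
    finally show ?thesis using LX_LY[OF s a(1), of "ry y"] LY_diff[OF _ b(1), of y]
      by (auto simp: b_def)
  qed
  have "\<xi> (\<tau> x v) = \<xi> v" if x: "x \<in> X" for x v
  proof -
    have "v \<in> S.span (range (\<lambda>w. \<tau> w v0))" by (simp add: span_translates[OF v0])
    then show ?thesis
    proof (induction rule: S.span_induct)
      case base
      show ?case by (simp add: S.subspace_def tau_plus tau_scale l.add l.scale l.zero)
    next
      case (step v)
      then obtain w where w: "v = \<tau> w v0" by blast
      obtain x' y where xy: "x' \<in> X" "y \<in> Y" "w = x' + y" using decompose by blast
      have v: "v = smulS (\<psi> (- (form x' y / 2))) (\<tau> x' (\<tau> y v0))"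
        unfolding w xy(3) by (rule tau_add)
      show ?case
        by (simp only: v tau_scale tau_X[OF x xy(1)] l.scale val[OF X_add[OF x xy(1)] xy(2)] val[OF xy(1,2)])
    qed
  qed
  moreover have "\<xi> (\<tau> y v0) = (if y \<in> LY s then 1 else 0)" if "y \<in> Y" for y
    using val[OF X_zero that] by simp
  ultimately show thesis using that[OF lam(1)] by simp
qed

text \<open>
  The space of \<open>c-Ind\<close> from \<open>X \<times> F\<close> to the Heisenberg group of the character \<open>\<psi>\<close>, restricted
  to \<open>W\<close>; compactness of the support modulo \<open>X\<close> is automatic.
\<close>

definition Ind :: "('w \<Rightarrow> 'r) set" where
  "Ind = {\<phi>. (\<forall>x\<in>X. \<forall>w. \<phi> (x + w) = \<psi> (- (form x w / 2)) * \<phi> w) \<and>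
     (\<exists>U. openin (vs_topology absF smul) U \<and> 0 \<in> U \<and>
        (\<forall>u\<in>U. \<forall>w. \<phi> (w + u) = \<psi> (- (form w u / 2)) * \<phi> w))}"

text \<open>The kernel of the map is a stable subspace missing \<open>v0\<close>, hence 0. For
  surjectivity, a function in \<open>Ind\<close> is determined by its restriction to
  \<open>Y\<close>, which is a finite combination of indicators of cosets of a small lattice; such
  indicators are realised by vectors.\<close>

lemma exists_schrodinger_model:
  obtains \<xi> where "Vector_Spaces.linear smulS (*) \<xi>"
    "\<And>v. (\<lambda>w. \<xi> (\<tau> w v)) \<in> Ind"
    "\<And>v. (\<forall>w. \<xi> (\<tau> w v) = 0) \<Longrightarrow> v = 0"
    "\<And>\<phi>. \<phi> \<in> Ind \<Longrightarrow> \<exists>v. \<forall>w. \<xi> (\<tau> w v) = \<phi> w"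
proof -
  obtain s v0 where s: "s \<noteq> 0" and v0: "v0 \<noteq> 0" and fixX: "\<And>a. a \<in> LX s \<Longrightarrow> \<tau> a v0 = v0"
    and fixY: "\<And>b. b \<in> LY s \<Longrightarrow> \<tau> b v0 = v0"
    by (rule exists_lattice_fixed_vector, rule that)
  obtain \<xi> where lam: "Vector_Spaces.linear smulS (*) \<xi>" and inv: "\<And>x v. x \<in> X \<Longrightarrow> \<xi> (\<tau> x v) = \<xi> v"
    and val: "\<And>y. y \<in> Y \<Longrightarrow> \<xi> (\<tau> y v0) = (if y \<in> LY s then 1 else 0)"
    by (rule exists_X_invariant_functional[OF s v0]) (erule fixX, erule fixY, rule that)
  interpret l: Vector_Spaces.linear smulS "(*)" \<xi> by (rule lam)
  have Ind: "(\<lambda>w. \<xi> (\<tau> w v)) \<in> Ind" for v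
  proof -
    obtain U where "openin (vs_topology absF smul) U" "0 \<in> U" "\<And>u. u \<in> U \<Longrightarrow> \<tau> u v = v"
      by (rule stabilizer_open[of v], rule that)
    then show ?thesis unfolding Ind_def
      by (auto simp: tau_add l.scale inv intro!: exI[of _ U])
  qed
  have ker: "v = 0" if v: "\<forall>w. \<xi> (\<tau> w v) = 0" for v
  proof -
    let ?V = "{v. \<forall>w. \<xi> (\<tau> w v) = 0}"
    have "?V = {0} \<or> ?V = UNIV"
    proof (rule S.irreducible)
      show "S.subspace ?V" by (simp add: S.subspace_def tau_plus tau_scale l.add l.scale l.zero)
      show "\<forall>h. \<rho> h ` ?V \<subseteq> ?V" by (auto simp: rho_tau tau_scale tau_tau l.scale)
    qed
    moreover have "\<xi> (\<tau> 0 v0) \<noteq> 0" using val[OF Y_zero] LY_zero[of s] by simp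
    then have "v0 \<notin> ?V" by blast
    ultimately show ?thesis using v by blast
  qed
  have surj: "\<exists>v. \<forall>w. \<xi> (\<tau> w v) = \<phi> w" if phi: "\<phi> \<in> Ind" for \<phi>
  proof -
    obtain U where U: "openin (vs_topology absF smul) U" "0 \<in> U"
        "\<And>u w. u \<in> U \<Longrightarrow> \<phi> (w + u) = \<psi> (- (form w u / 2)) * \<phi> w"
      and phiX: "\<And>x w. x \<in> X \<Longrightarrow> \<phi> (x + w) = \<psi> (- (form x w / 2)) * \<phi> w"
      using phi unfolding Ind_def by blast
    obtain s1 where s1: "s1 \<noteq> 0" "LX s1 \<subseteq> U" by (rule LX_small[OF U(1,2)], rule that)
    obtain s2 where s2: "s2 \<noteq> 0" "LY s2 \<subseteq> U" "LY s2 \<subseteq> LY s"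
      by (rule LY_small[OF U(1,2) s], rule that)
    \<comment> \<open>The value at \<open>x + y\<close> is computed by equivariance under
      \<open>X\<close> on the left and by smoothness on the right. The two results differ by the
      factor \<psi> (form x y), so a point of the support lies in the lattice dual to
      \<open>LX s1\<close>.\<close>
    have supp: "y \<in> LY s1" if y: "y \<in> Y" "\<phi> y \<noteq> 0" for y
    proof (rule LY_dual[OF y(1)])
      fix x assume x: "x \<in> LX s1"
      have "\<phi> (y + x) = \<psi> (- (form y x / 2)) * \<phi> y" using U(3) x s1(2) by blast
      moreover have "\<phi> (x + y) = \<psi> (- (form x y / 2)) * \<phi> y" using phiX x LX_sub by blast
      ultimately have "\<psi> (form x y / 2) = \<psi> (- (form x y / 2))"
        using y(2) V.form_swap[of y x] by (simp add: add.commute)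
      then have "\<psi> (form x y / 2) * \<psi> (form x y / 2) = \<psi> (form x y / 2) * \<psi> (- (form x y / 2))"
        by (rule arg_cong)
      then show "\<psi> (form x y) = 1" using two by (simp flip: psi_add)
    qed
    have per: "\<phi> (y + b) = \<phi> y" if "y \<in> Y" "b \<in> LY s2" for y b
    proof -
      have "form y b = 0" using that LY_sub Y_isotropic by blast
      then show ?thesis using U(3)[of b y] that s2(2) by auto
    qed
    \<comment> \<open>On \<open>Y\<close> the vector \<open>v0\<close> realises the indicator of
      \<open>LY s\<close>. Applying \<tau> x multiplies a realised function by the character y
      \<mapsto> \<psi> (form y x), and combinations of these cut the indicator down to
      \<open>LY s2\<close>.\<close>
    have "\<exists>u0. \<forall>y\<in>Y. \<xi> (\<tau> y u0) = (if y \<in> LY s2 then 1 else 0)"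
    proof -
      obtain T where T: "finite T" "T \<subseteq> LY s" "\<And>y. y \<in> LY s \<Longrightarrow> \<exists>!t. t \<in> T \<and> y - t \<in> LY s2"
        by (rule LY_transversal[OF s s2(1)], rule that)
      obtain t0 where t0: "t0 \<in> T" "0 - t0 \<in> LY s2" using T(3)[OF LY_zero] by blast
      have t0': "t0 \<in> LY s2" using LY_diff[OF LY_zero t0(2)] by simp
      have TY: "t \<in> Y" if "t \<in> T" for t using that T(2) LY_sub by blast
      \<comment> \<open>Periodicity and support are recorded along with realisability so that a
        function in \<open>C\<close> is known on all of \<open>Y\<close> from its values on
        \<open>T\<close>.\<close>
      define C where "C = {g. (\<exists>u. \<forall>y\<in>Y. \<xi> (\<tau> y u) = g y) \<and>
          (\<forall>y\<in>Y. \<forall>b\<in>LY s2. g (y + b) = g y) \<and> (\<forall>y\<in>Y - LY s. g y = 0)}"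
      have "\<exists>g\<in>C. g t0 = \<xi> (\<tau> t0 v0) \<and> (\<forall>t\<in>T - {t0}. g t = 0)"
      proof (rule delta_function[where \<theta> = "\<lambda>x y. \<psi> (form y x)" and Z = "LX s2"
            and h = "\<lambda>y. \<xi> (\<tau> y v0)"])
        have "\<xi> (\<tau> (y + b) v0) = \<xi> (\<tau> y v0)" if "y \<in> Y" "b \<in> LY s2" for y b
          using tau_Y[of y b v0] that LY_sub s2(3) fixY by (metis subsetD)
        then show "(\<lambda>y. \<xi> (\<tau> y v0)) \<in> C" using val by (auto simp: C_def intro!: exI[of _ v0])
        show "(\<lambda>t. g t + g' t) \<in> C" if g: "g \<in> C" "g' \<in> C" for g g'
        proof -
          obtain u u' where "\<forall>y\<in>Y. \<xi> (\<tau> y u) = g y" "\<forall>y\<in>Y. \<xi> (\<tau> y u') = g' y"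
            using g by (auto simp: C_def)
          then have "\<forall>y\<in>Y. \<xi> (\<tau> y (u + u')) = g y + g' y" by (simp add: tau_plus l.add)
          then show ?thesis using g by (auto simp: C_def)
        qed
        show "(\<lambda>t. a * g t) \<in> C" if g: "g \<in> C" for g a
        proof -
          obtain u where "\<forall>y\<in>Y. \<xi> (\<tau> y u) = g y" using g by (auto simp: C_def)
          then have "\<forall>y\<in>Y. \<xi> (\<tau> y (smulS a u)) = a * g y" by (simp add: tau_scale l.scale)
          then show ?thesis using g by (auto simp: C_def)
        qed
        show "(\<lambda>t. \<psi> (form t x) * g t) \<in> C" if g: "g \<in> C" and x: "x \<in> LX s2" for g x
        proof -
          obtain u where u: "\<forall>y\<in>Y. \<xi> (\<tau> y u) = g y" using g by (auto simp: C_def)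
          have "\<xi> (\<tau> y (\<tau> x u)) = \<psi> (form y x) * g y" if "y \<in> Y" for y
            using inv[OF subsetD[OF LX_sub x]] u that by (subst tau_commute) (simp add: l.scale)
          moreover have "\<psi> (form (y + b) x) = \<psi> (form y x)" if "b \<in> LY s2" for y b
            using LX_LY[OF s2(1) x that] psi_form_swap[of b x] by (simp add: V.form_add_left psi_add)
          ultimately show ?thesis using g by (auto simp: C_def)
        qed
        show "\<exists>x\<in>LX s2. \<psi> (form t x) \<noteq> \<psi> (form t0 x)" if t: "t \<in> T" "t \<noteq> t0" for t
        proof -
          have "t - t \<in> LY s2" by (simp add: LY_zero)
          then have "t - t0 \<notin> LY s2" using T(3)[of t] T(2) t t0(1) by blast
          then obtain x where "x \<in> LX s2" "\<psi> (form x t) \<noteq> \<psi> (form x t0)"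
            using LY_sep[OF TY[OF t(1)] TY[OF t0(1)]] by blast
          then show ?thesis using psi_form_swap[of t x] psi_form_swap[of t0 x] by (intro bexI[of _ x]) simp_all
        qed
      qed (rule T(1))
      then obtain g where g: "g \<in> C" "g t0 = 1" "\<forall>t\<in>T - {t0}. g t = 0"
        using val[OF TY[OF t0(1)]] t0 T(2) by auto
      have "g y = (if y \<in> LY s2 then 1 else 0)" if y: "y \<in> Y" for y
      proof (cases "y \<in> LY s")
        case True
        then obtain t where t: "t \<in> T" "y - t \<in> LY s2" using T(3) by blast
        have "g (t + (y - t)) = g t" using g(1) TY[OF t(1)] t(2) unfolding C_def by blast
        moreover have "t = t0 \<longleftrightarrow> y \<in> LY s2"
        proof
          show "y \<in> LY s2" if "t = t0" using LY_add[OF t(2) t0'] that by simp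
          assume "y \<in> LY s2"
          then have "t \<in> LY s2" using LY_diff[OF _ t(2), of y] by simp
          then have "t - t0 \<in> LY s2" "t - t \<in> LY s2" using LY_diff[OF _ t0'] LY_zero by simp_all
          then show "t = t0" using T(3)[of t] t(1) t0(1) T(2) by blast
        qed
        ultimately show ?thesis using g t(1) by auto
      next
        case False
        then show ?thesis using g(1) y s2(3) by (auto simp: C_def)
      qed
      then show ?thesis using g(1) by (auto simp: C_def)
    qed
    then obtain u0 where u0: "\<And>y. y \<in> Y \<Longrightarrow> \<xi> (\<tau> y u0) = (if y \<in> LY s2 then 1 else 0)" by blast
    obtain T where T: "finite T" "T \<subseteq> LY s1" "\<And>y. y \<in> LY s1 \<Longrightarrow> \<exists>!t. t \<in> T \<and> y - t \<in> LY s2"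
      by (rule LY_transversal[OF s1(1) s2(1)], rule that)
    have TY: "t \<in> Y" if "t \<in> T" for t using that T(2) LY_sub by blast
    \<comment> \<open>On \<open>Y\<close>, \<tau> (0 - t) u0 realises the indicator of the coset of
      \<open>t\<close> modulo \<open>LY s2\<close>.\<close>
    define u where "u = (\<Sum>t\<in>T. smulS (\<phi> t) (\<tau> (0 - t) u0))"
    have onY: "\<xi> (\<tau> y u) = \<phi> y" if y: "y \<in> Y" for y
    proof -
      have val0: "\<xi> (\<tau> y (\<tau> (0 - t) u0)) = (if y - t \<in> LY s2 then 1 else 0)" if "t \<in> T" for t
        using tau_Y[OF y Y_diff[OF Y_zero TY[OF that]]] u0[OF Y_diff[OF y TY[OF that]]] by simp
      have "\<xi> (\<tau> y u) = (\<Sum>t\<in>T. \<phi> t * \<xi> (\<tau> y (\<tau> (0 - t) u0)))"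
        by (simp only: u_def tau_sum tau_scale l.sum l.scale)
      also have "\<dots> = (\<Sum>t\<in>T. if y - t \<in> LY s2 then \<phi> t else 0)"
        by (rule sum.cong) (simp_all only: val0 if_distrib[of "\<lambda>z. _ * z"] mult_1_right mult_zero_right)
      \<comment> \<open>Periodicity turns \<phi> t into \<phi> y. This also settles a point
        \<open>y\<close> outside \<open>LY s1\<close> that is congruent to some \<open>t\<close>,
        since \<phi> y = 0 there.\<close>
      also have "\<dots> = (\<Sum>t\<in>T. if y - t \<in> LY s2 then \<phi> y else 0)"
      proof (rule sum.cong[OF refl])
        fix t assume "t \<in> T"
        then show "(if y - t \<in> LY s2 then \<phi> t else 0) = (if y - t \<in> LY s2 then \<phi> y else 0)"
          using per[OF TY, of t "y - t"] by simp
      qed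
      also have "\<dots> = \<phi> y"
      proof (cases "y \<in> LY s1")
        case True
        from T(3)[OF this] obtain t where t: "t \<in> T \<and> y - t \<in> LY s2"
            "\<forall>t'. t' \<in> T \<and> y - t' \<in> LY s2 \<longrightarrow> t' = t"
          by (rule ex1E)
        have "(\<Sum>t\<in>T. if y - t \<in> LY s2 then \<phi> y else 0) = (\<Sum>t'\<in>T. if t' = t then \<phi> y else 0)"
        proof (rule sum.cong[OF refl])
          fix t' assume "t' \<in> T"
          then have "y - t' \<in> LY s2 \<longleftrightarrow> t' = t" using t by blast
          then show "(if y - t' \<in> LY s2 then \<phi> y else 0) = (if t' = t then \<phi> y else 0)" by simp
        qed
        then show ?thesis using T(1) t(1) by simp
      next
        case False
        then have "\<phi> y = 0" using supp[OF y] by blast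
        then show ?thesis by (simp cong: if_cong)
      qed
      finally show ?thesis .
    qed
    have "\<xi> (\<tau> w u) = \<phi> w" for w
    proof -
      obtain x y where xy: "x \<in> X" "y \<in> Y" "w = x + y" using decompose by blast
      show ?thesis using phiX[OF xy(1)] inv[OF xy(1)] onY[OF xy(2)]
        by (simp add: xy(3) tau_add l.scale)
    qed
    then show ?thesis by blast
  qed
  show thesis using that lam Ind ker surj by blast
qed

section \<open>The action of the stabiliser of a Lagrangian subspace\<close>

lemma vs_topology_vimage:
  assumes "Vector_Spaces.linear smul smul g" "bij g" "openin (vs_topology absF smul) U"
  shows "openin (vs_topology absF smul) {w. g w \<in> U}"
  unfolding openin_vs_topology
proof (intro ballI allI impI)
  interpret g: Vector_Spaces.linear smul smul g by (rule assms(1))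
  have inj: "inj_on g A" for A using assms(2) by (meson bij_is_inj inj_on_subset subset_UNIV)
  fix w B assume w: "w \<in> {w. g w \<in> U}" and B: "finite (B :: 'w set)"
  then have "finite (g ` B)" by simp
  then obtain \<epsilon> where \<epsilon>: "\<epsilon> > 0"
      "\<And>c. \<forall>b\<in>g ` B. absF (c b) < \<epsilon> \<Longrightarrow> g w + (\<Sum>b\<in>g ` B. smul (c b) b) \<in> U"
    using assms(3) w unfolding openin_vs_topology by blast
  have "g (w + (\<Sum>b\<in>B. smul (c b) b)) \<in> U" if c: "\<forall>b\<in>B. absF (c b) < \<epsilon>" for c
  proof -
    have "g w + (\<Sum>b\<in>g ` B. smul (c (inv_into UNIV g b)) b) \<in> U"
      by (rule \<epsilon>(2)) (use c inj in \<open>auto simp: inv_f_f\<close>)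
    also have "(\<Sum>b\<in>g ` B. smul (c (inv_into UNIV g b)) b) = (\<Sum>b\<in>B. smul (c b) (g b))"
      by (simp add: sum.reindex[OF inj] inv_f_f[OF inj])
    finally show ?thesis by (simp add: g.add g.sum g.scale)
  qed
  then show "\<exists>\<epsilon>>0. \<forall>c. (\<forall>b\<in>B. absF (c b) < \<epsilon>) \<longrightarrow> w + (\<Sum>b\<in>B. smul (c b) b) \<in> {w. g w \<in> U}"
    using \<epsilon>(1) by blast
qed

lemma Ind_comp:
  assumes g: "g \<in> carrier (Sp smul form)" "\<And>x. x \<in> X \<Longrightarrow> g x \<in> X" and phi: "\<phi> \<in> Ind"
  shows "(\<lambda>w. \<phi> (g w)) \<in> Ind"
proof -
  have lin: "Vector_Spaces.linear smul smul g" and "bij g" and form: "form (g w) (g w') = form w w'" for w w'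
    using g(1) by (auto simp: Sp_def)
  interpret g: Vector_Spaces.linear smul smul g by (rule lin)
  obtain U where U: "openin (vs_topology absF smul) U" "0 \<in> U"
      "\<And>u w. u \<in> U \<Longrightarrow> \<phi> (w + u) = \<psi> (- (form w u / 2)) * \<phi> w"
    and phiX: "\<And>x w. x \<in> X \<Longrightarrow> \<phi> (x + w) = \<psi> (- (form x w / 2)) * \<phi> w"
    using phi unfolding Ind_def by blast
  have "\<phi> (g (x + w)) = \<psi> (- (form x w / 2)) * \<phi> (g w)" if "x \<in> X" for x w
    using phiX[OF g(2)[OF that], of "g w"] by (simp add: g.add form)
  moreover have "\<phi> (g (w + u)) = \<psi> (- (form w u / 2)) * \<phi> (g w)" if "g u \<in> U" for u w
    using U(3)[OF that, of "g w"] by (simp add: g.add form)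
  ultimately show ?thesis
    using vs_topology_vimage[OF lin \<open>bij g\<close> U(1)] U(2) unfolding Ind_def
    by (auto intro!: exI[of _ "{w. g w \<in> U}"] simp: g.zero)
qed

text \<open>\<open>M g\<close> is \<phi> \<mapsto> \<phi> \<circ> g carried back to the given space
  through \<xi>. Vectors are determined by their functions, so identities between operators are
  checked on functions and hold exactly, not up to scalars.\<close>

theorem Mp_split_stabilizer:
  assumes H: "H \<subseteq> carrier (Sp smul form)" and HX: "\<And>g x. g \<in> H \<Longrightarrow> x \<in> X \<Longrightarrow> g x \<in> X"
  shows "Mp_split smul form smulS \<rho> H"
proof -
  obtain \<xi> where lam: "Vector_Spaces.linear smulS (*) \<xi>" and Ind: "\<And>v. (\<lambda>w. \<xi> (\<tau> w v)) \<in> Ind"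
    and ker: "\<And>v. (\<forall>w. \<xi> (\<tau> w v) = 0) \<Longrightarrow> v = 0"
    and surj: "\<And>\<phi>. \<phi> \<in> Ind \<Longrightarrow> \<exists>v. \<forall>w. \<xi> (\<tau> w v) = \<phi> w"
    by (rule exists_schrodinger_model) blast
  interpret l: Vector_Spaces.linear smulS "(*)" \<xi> by (rule lam)
  have eqI: "u = v" if "\<And>w. \<xi> (\<tau> w u) = \<xi> (\<tau> w v)" for u v
  proof -
    have "\<xi> (\<tau> w (u + smulS (-1) v)) = 0" for w
      using that[of w] by (simp add: tau_plus l.add tau_scale l.scale l.neg del: S.scale_minus_left)
    then have "u + smulS (-1) v = 0" by (intro ker) blast
    then show ?thesis by simp
  qed
  define P where "P = {g \<in> carrier (Sp smul form). \<forall>x\<in>X. g x \<in> X}"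
  define M where "M g v = (SOME u. \<forall>w. \<xi> (\<tau> w u) = \<xi> (\<tau> (g w) v))" for g v
  have M: "\<xi> (\<tau> w (M g v)) = \<xi> (\<tau> (g w) v)" if "g \<in> P" for g v w
  proof -
    have "\<exists>u. \<forall>w. \<xi> (\<tau> w u) = \<xi> (\<tau> (g w) v)"
      using surj[OF Ind_comp[OF _ _ Ind]] that by (simp add: P_def)
    from someI_ex[OF this] show ?thesis unfolding M_def by blast
  qed
  have P_lin: "Vector_Spaces.linear smul smul g" and P_bij: "bij g"
    and P_form: "form (g w) (g w') = form w w'" if "g \<in> P" for g w w'
    using that by (auto simp: P_def Sp_def)
  have inverse: "inv_into UNIV g \<in> P" if g: "g \<in> P" for g
  proof -
    let ?h = "inv_into UNIV g"
    interpret g: Vector_Spaces.linear smul smul g by (rule P_lin[OF g])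
    have gh: "g (?h w) = w" and hg: "?h (g w) = w" for w
      using P_bij[OF g] by (simp_all add: bij_is_surj surj_f_inv_f bij_is_inj)
    have "?h (u + v) = ?h u + ?h v" for u v using hg[of "?h u + ?h v"] by (simp add: g.add gh)
    moreover have "?h (smul c v) = smul c (?h v)" for c v using hg[of "smul c (?h v)"] by (simp add: g.scale gh)
    ultimately have "Vector_Spaces.linear smul smul ?h"
      using V.vector_space_axioms by (simp add: Vector_Spaces.linear_iff)
    moreover have "bij ?h" using P_bij[OF g] by (rule bij_imp_bij_inv)
    moreover have "form (?h w) (?h w') = form w w'" for w w'
      using P_form[OF g, of "?h w" "?h w'"] by (simp add: gh)
    moreover have "?h x \<in> X" if x: "x \<in> X" for x
    proof -
      \<comment> \<open>Since \<open>X\<close> is cut out by orthogonality to \<open>E\<close>,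
        invariance of the form moves \<open>g\<close> to the other argument; this replaces a
        dimension count for the inverse.\<close>
      have "form e (?h x) = 0" if e: "e \<in> E" for e
      proof -
        have "e \<in> X" using e form_E by (auto simp: X_def)
        then have "form (g e) x = 0" using g x X_isotropic by (auto simp: P_def)
        then show ?thesis using P_form[OF g, of e "?h x"] by (simp add: gh)
      qed
      then show ?thesis by (simp add: X_def)
    qed
    ultimately show ?thesis by (simp add: P_def Sp_def)
  qed
  \<comment> \<open>\<open>h \<circ> g\<close> is the product of \<open>g\<close> and
    \<open>h\<close> in \<open>Sp\<close>, so this is multiplicativity without reversal.\<close>
  have comp: "M (h \<circ> g) = M g \<circ> M h" if g: "g \<in> P" and h: "h \<in> P" for g h
  proof
    fix v
    have "h \<circ> g \<in> P"
      using g h Vector_Spaces.linear_compose[of smul smul g smul h] bij_comp[of g h]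
      by (auto simp: P_def Sp_def)
    then show "M (h \<circ> g) v = (M g \<circ> M h) v" by (intro eqI) (simp add: M g h)
  qed
  have M_id: "M id = id"
  proof
    fix v
    have "Vector_Spaces.linear smul smul id"
      using V.vector_space_axioms by (simp add: Vector_Spaces.linear_iff)
    then have "id \<in> P" by (simp add: P_def Sp_def)
    then show "M id v = id v" by (intro eqI) (simp add: M)
  qed
  have M_bij: "bij (M g)" if g: "g \<in> P" for g
  proof (rule o_bij)
    have "inv_into UNIV g \<circ> g = id" "g \<circ> inv_into UNIV g = id"
      using P_bij[OF g] by (simp_all add: bij_is_inj bij_is_surj flip: surj_iff)
    then show "M (inv_into UNIV g) \<circ> M g = id" "M g \<circ> M (inv_into UNIV g) = id"
      using comp[OF g inverse[OF g]] comp[OF inverse[OF g] g] M_id by simp_all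
  qed
  have M_lin: "Vector_Spaces.linear smulS smulS (M g)" if g: "g \<in> P" for g
  proof -
    have "M g (u + v) = M g u + M g v" for u v
      by (rule eqI) (simp add: tau_plus l.add M[OF g])
    moreover have "M g (smulS c v) = smulS c (M g v)" for c v
      by (rule eqI) (simp add: tau_scale l.scale M[OF g])
    ultimately show ?thesis using S.vector_space_axioms by (simp add: Vector_Spaces.linear_iff)
  qed
  have M_rho: "M g \<circ> \<rho> (w, t) \<circ> inv_into UNIV (M g) = \<rho> (inv_into UNIV g w, t)" if g: "g \<in> P" for g w t
  proof
    fix v
    interpret g: Vector_Spaces.linear smul smul g by (rule P_lin[OF g])
    have gi: "g (inv_into UNIV g w) = w" using P_bij[OF g] by (simp add: bij_is_surj surj_f_inv_f)
    define u where "u = inv_into UNIV (M g) v"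
    have v: "v = M g u" using M_bij[OF g] by (simp add: u_def bij_is_surj surj_f_inv_f)
    have "M g (\<rho> (w, t) u) = \<rho> (inv_into UNIV g w, t) (M g u)"
    proof (rule eqI)
      fix w'
      \<comment> \<open>Since g w' + w = g (w' + inv g w), the translations match, and this equation
        matches the cocycle factors.\<close>
      have "form (g w') w = form w' (inv_into UNIV g w)"
        using P_form[OF g, of w' "inv_into UNIV g w"] by (simp add: gi)
      then show "\<xi> (\<tau> w' (M g (\<rho> (w, t) u))) = \<xi> (\<tau> w' (\<rho> (inv_into UNIV g w, t) (M g u)))"
        by (simp add: M[OF g] rho_tau tau_scale tau_tau l.scale g.add gi)
    qed
    then show "(M g \<circ> \<rho> (w, t) \<circ> inv_into UNIV (M g)) v = \<rho> (inv_into UNIV g w, t) v"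
      by (simp add: u_def[symmetric] v[symmetric])
  qed
  have HP: "g \<in> P" if "g \<in> H" for g using that H HX by (auto simp: P_def)
  have "(\<lambda>g. (g, M g)) \<in> hom ((Sp smul form)\<lparr>carrier := H\<rparr>) (Mp_preimage smul form smulS \<rho> H)"
  proof (rule homI)
    fix g assume "g \<in> carrier ((Sp smul form)\<lparr>carrier := H\<rparr>)"
    then have g: "g \<in> H" by simp
    then show "(g, M g) \<in> carrier (Mp_preimage smul form smulS \<rho> H)"
      using H M_lin[OF HP] M_bij[OF HP] M_rho[OF HP] by (auto simp: Mp_preimage_def Mp_def GL_def)
  next
    fix g h assume "g \<in> carrier ((Sp smul form)\<lparr>carrier := H\<rparr>)" "h \<in> carrier ((Sp smul form)\<lparr>carrier := H\<rparr>)"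
    then show "(g \<otimes>\<^bsub>(Sp smul form)\<lparr>carrier := H\<rparr>\<^esub> h, M (g \<otimes>\<^bsub>(Sp smul form)\<lparr>carrier := H\<rparr>\<^esub> h)) =
        (g, M g) \<otimes>\<^bsub>Mp_preimage smul form smulS \<rho> H\<^esub> (h, M h)"
      using comp[OF HP HP] by (simp add: Mp_preimage_def Mp_def Sp_def GL_def DirProd_def)
  qed
  then show ?thesis unfolding Mp_split_def by (intro bexI) auto
qed

end

section \<open>Lagrangian subspaces stable under dual pairs\<close>

lemma Mp_split_lagrangian_stabilizer:
  fixes absF :: "'f::field \<Rightarrow> real" and smul :: "'f \<Rightarrow> 'w::ab_group_add \<Rightarrow> 'w"
    and \<psi> :: "'f \<Rightarrow> 'r::field" and smulS :: "'r \<Rightarrow> 's::ab_group_add \<Rightarrow> 's"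
  assumes field: "nonarch_local_field absF p" and char: "CHAR('f) \<noteq> 2"
    and sympl: "symplectic_space smul form"
    and psi: "smooth_character absF \<psi>" "\<exists>x. \<psi> x \<noteq> 1"
    and rep: "heisenberg_rep smulS absF smul form \<psi> \<rho>"
    and X: "module.subspace smul X" "\<And>x x'. x \<in> X \<Longrightarrow> x' \<in> X \<Longrightarrow> form x x' = 0"
      "\<And>w. (\<forall>x\<in>X. form x w = 0) \<Longrightarrow> w \<in> X"
    and H: "H \<subseteq> carrier (Sp smul form)" "\<And>g x. g \<in> H \<Longrightarrow> x \<in> X \<Longrightarrow> g x \<in> X"
  shows "Mp_split smul form smulS \<rho> H"
proof -
  interpret symplectic_space smul form by (rule sympl)
  obtain E f where E: "finite E" "E \<subseteq> X" "X = {w. \<forall>e\<in>E. form e w = 0}"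
    "\<And>e e'. e \<in> E \<Longrightarrow> e' \<in> E \<Longrightarrow> form (f e) (f e') = 0"
    "\<And>e e'. e \<in> E \<Longrightarrow> e' \<in> E \<Longrightarrow> form e (f e') = (if e = e' then 1 else 0)"
    "\<And>w. w = (\<Sum>e\<in>E. smul (form w (f e)) e) + (\<Sum>e\<in>E. smul (form e w) (f e))"
    by (rule lagrangian_symplectic_basis[OF char X(1)]) (erule (1) X(2), erule X(3), rule that)
  have EX: "form e e' = 0" if "e \<in> E" "e' \<in> E" for e e' using that E(2) X(2) by blast
  have "local_field_character_axioms absF \<psi>" using psi by unfold_locales
  moreover have "symplectic_basis_axioms smul form E f"
    using E(1,4,5) EX E(6) by unfold_locales
  moreover have "heisenberg_polarization_axioms TYPE('f)" using two_nonzero[OF char] by unfold_locales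
  ultimately interpret P: heisenberg_polarization absF p \<psi> smul form E f smulS \<rho>
    using field sympl rep
    by (simp add: heisenberg_polarization_def symplectic_basis_def local_field_character_def)
  have "P.X = X" unfolding P.X_def E(3) ..
  then show ?thesis using H by (intro P.Mp_split_stabilizer) auto
qed

lemma (in symplectic_space) span_isotropic:
  assumes "\<And>g g'. g \<in> G \<Longrightarrow> g' \<in> G \<Longrightarrow> form g g' = 0" "x \<in> span G" "x' \<in> span G"
  shows "form x x' = 0"
proof -
  have *: "form g y = 0" if "g \<in> G" "y \<in> span G" for g y
    using that(2)
  proof (induction rule: span_induct)
    case base
    show ?case by (simp add: subspace_def form_add_right form_scale_right)
  qed (rule assms(1)[OF that(1)])
  show ?thesis
    using assms(2)
  proof (induction rule: span_induct)
    case base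
    show ?case by (simp add: subspace_def form_add_left form_scale_left)
  qed (rule *[OF _ assms(3)])
qed

section \<open>Calculus in tensor products over a division algebra\<close>

context
  fixes smul :: "'f::field \<Rightarrow> 'w::ab_group_add \<Rightarrow> 'w" and smulD :: "'f \<Rightarrow> 'd::division_ring \<Rightarrow> 'd"
    and ract :: "'x1::ab_group_add \<Rightarrow> 'd \<Rightarrow> 'x1" and lact :: "'d \<Rightarrow> 'x2::ab_group_add \<Rightarrow> 'x2"
    and tens :: "'x1 \<Rightarrow> 'x2 \<Rightarrow> 'w" and X :: "'w set"
  assumes vs: "vector_space smul" and tensor: "is_tensor_product smul smulD ract lact tens X"
begin

interpretation vector_space smul by (rule vs)

text \<open>The local \<open>ext\<close> of \<open>is_tensor_product\<close>, named so that each
  generating relation can be read as an identity for \<open>tens\<close>.\<close>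

definition tensor_extension :: "('x1 \<times> 'x2 \<Rightarrow>\<^sub>0 int) \<Rightarrow> 'w" where
  "tensor_extension u = (\<Sum>(x, y) \<in> Poly_Mapping.keys u.
     smul (of_int (Poly_Mapping.lookup u (x, y))) (tens x y))"

lemma tensor_extension_superset:
  assumes "finite A" "Poly_Mapping.keys u \<subseteq> A"
  shows "tensor_extension u = (\<Sum>(x, y) \<in> A. smul (of_int (Poly_Mapping.lookup u (x, y))) (tens x y))"
  unfolding tensor_extension_def
  by (rule sum.mono_neutral_left) (use assms in \<open>auto simp: in_keys_iff\<close>)

lemma tensor_extension_diff: "tensor_extension (u - v) = tensor_extension u - tensor_extension v"
proof -
  let ?A = "Poly_Mapping.keys u \<union> Poly_Mapping.keys v"
  have "Poly_Mapping.keys (u - v) \<subseteq> ?A" by (auto simp: in_keys_iff lookup_minus)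
  then show ?thesis
    by (simp add: tensor_extension_superset[of ?A] lookup_minus scale_left_diff_distrib
        sum_subtractf case_prod_unfold)
qed

lemma tensor_extension_single: "tensor_extension (Poly_Mapping.single (x, y) 1) = tens x y"
  by (simp add: tensor_extension_def)

lemma tensor_extension_relation: "u \<in> tensor_relations ract lact \<Longrightarrow> tensor_extension u = 0"
  using tensor unfolding is_tensor_product_def Let_def tensor_extension_def by blast

lemma tensor_add_left: "tens (x + x') y = tens x y + tens x' y"
  using tensor_extension_relation[OF tensor_relations.add_left]
  unfolding tensor_extension_diff tensor_extension_single by (simp add: algebra_simps)

lemma tensor_add_right: "tens x (y + y') = tens x y + tens x y'"
  using tensor_extension_relation[OF tensor_relations.add_right]
  unfolding tensor_extension_diff tensor_extension_single by (simp add: algebra_simps)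

lemma tensor_balanced: "tens (ract x d) y = tens x (lact d y)"
  using tensor_extension_relation[OF tensor_relations.balanced]
  by (simp add: tensor_extension_diff tensor_extension_single)

lemma tensor_scale: "smul a (tens x y) = tens (ract x (smulD a 1)) y"
  using tensor unfolding is_tensor_product_def by blast

lemma tensor_span: "w \<in> X \<Longrightarrow> w \<in> module.span smul {tens x y |x y. True}"
proof -
  assume "w \<in> X"
  then have "w \<in> range tensor_extension"
    using tensor unfolding is_tensor_product_def Let_def tensor_extension_def by blast
  then obtain u where u: "w = tensor_extension u" by blast
  show ?thesis unfolding u tensor_extension_def
    by (rule span_sum) (auto intro!: span_scale intro: span_base)
qed

end

lemma (in left_D_space) D_span_base:
  assumes "finite B" "b \<in> B"
  shows "b \<in> D_span lact B"
proof -
  have "(\<Sum>b'\<in>B. lact (if b' = b then 1 else 0) b') = (\<Sum>b'\<in>B. if b' = b then b else 0)"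
    by (rule sum.cong) (auto simp: lact_one)
  then have "b = (\<Sum>b'\<in>B. lact (if b' = b then 1 else 0) b')" using assms by simp
  then show ?thesis
    unfolding D_span_def by (intro CollectI exI[of _ "\<lambda>b'. if b' = b then 1 else 0"] conjI TrueI)
qed

text \<open>Adjoining \<open>y\<close> under the index \<open>None\<close> makes the family too
  large to be independent, and independence of \<open>f\<close> forces the coefficient of
  \<open>y\<close> in a relation to be nonzero.\<close>

lemma (in left_D_space) independent_family_spans:
  fixes f :: "'i \<Rightarrow> 'x"
  assumes "finite B" "D_span lact B = UNIV" "finite J" "card B \<le> card J"
    and indep: "\<And>c. (\<Sum>j\<in>J. lact (c j) (f j)) = 0 \<Longrightarrow> \<forall>j\<in>J. c j = 0"
  shows "\<exists>c. y = (\<Sum>j\<in>J. lact (c j) (f j))"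
proof -
  define f' where "f' i = (case i of None \<Rightarrow> y | Some j \<Rightarrow> f j)" for i
  let ?J = "insert None (Some ` J)"
  have sum: "(\<Sum>i\<in>?J. lact (c i) (f' i)) = lact (c None) y + (\<Sum>j\<in>J. lact (c (Some j)) (f j))" for c
    using assms(3) by (simp add: f'_def sum.reindex)
  have "\<not> card ?J \<le> card B" using assms(3,4) by (simp add: card_image)
  then obtain c where c: "(\<Sum>i\<in>?J. lact (c i) (f' i)) = 0" "\<not> (\<forall>i\<in>?J. c i = 0)"
    using card_independent_family_le[of B ?J f'] assms(1,2,3) by auto
  have "c None \<noteq> 0"
  proof
    assume "c None = 0"
    then have "\<forall>j\<in>J. c (Some j) = 0" using c(1) indep[of "\<lambda>j. c (Some j)"] unfolding sum by simp
    then show False using c(2) \<open>c None = 0\<close> by auto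
  qed
  have "lact (c None) y = - (\<Sum>j\<in>J. lact (c (Some j)) (f j))"
    using c(1) unfolding sum by (simp add: eq_neg_iff_add_eq_0)
  then have "lact (inverse (c None)) (lact (c None) y) =
      lact (- inverse (c None)) (\<Sum>j\<in>J. lact (c (Some j)) (f j))"
    by (simp add: lact_uminus lact_diff_right[of _ 0, simplified])
  then have "y = (\<Sum>j\<in>J. lact (- inverse (c None) * c (Some j)) (f j))"
    using \<open>c None \<noteq> 0\<close> by (simp add: lact_lact lact_one lact_sum_right)
  then show ?thesis by (rule exI[of _ "\<lambda>j. - inverse (c None) * c (Some j)"])
qed

section \<open>The Lagrangian subspace attached to a split hermitian factor\<close>

context type_I_decomposition
begin

lemma star_one [simp]: "star 1 = 1"
  using D.star_mult[of "star 1" 1] by (simp add: D.star_star)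

lemma star_zero [simp]: "star 0 = 0"
proof -
  interpret s: Vector_Spaces.linear smulD smulD star by (rule D.star_linear)
  show ?thesis by (rule s.zero)
qed

lemma tr_zero [simp]: "tr 0 = 0"
proof -
  interpret t: Vector_Spaces.linear smulD "(*)" tr by (rule tr_linear)
  show ?thesis by (rule t.zero)
qed

lemma eps2_nonzero [simp]: "eps2 \<noteq> 0"
  using W2.sign by auto

lemma h2_left: "h2 (lact d x) y = d * h2 x y"
  using W2.sesquilinear[of d x 1 y] by (simp add: W2.lact_one)

lemma h2_right: "h2 x (lact e y) = h2 x y * star e"
  using W2.sesquilinear[of 1 x e y] by (simp add: W2.lact_one)

lemma h1_left: "h1 (ract x d) y = star d * h1 x y"
  using W1.sesquilinear[of x d y 1] by (simp add: W1.ract_one)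

lemmas tens_add_left = tensor_add_left[OF vector_space_axioms tensor]
  and tens_add_right = tensor_add_right[OF vector_space_axioms tensor]
  and tens_balanced = tensor_balanced[OF vector_space_axioms tensor]
  and tens_scale = tensor_scale[OF vector_space_axioms tensor]
  and tens_span = tensor_span[OF vector_space_axioms tensor]

lemma tens_zero [simp]: "tens 0 y = 0" "tens x 0 = 0"
  using tens_add_left[of 0 0 y] tens_add_right[of x 0 0] by simp_all

lemma tens_sum_right: "tens x (\<Sum>i\<in>I. g i) = (\<Sum>i\<in>I. tens x (g i))"
  by (induction I rule: infinite_finite_induct) (auto simp: tens_add_right)

text \<open>Over a division ring one nonzero value of \<open>h1\<close> can be rescaled through
  \<open>x\<close> to any element, in particular to one of nonzero trace.\<close>

lemma h1_trace_nondegenerate: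
  assumes "\<And>x. tr (h1 x z) = 0"
  shows "z = 0"
proof -
  have "h1 x z = 0" for x
  proof (rule ccontr)
    assume d: "h1 x z \<noteq> 0"
    obtain t where t: "tr t \<noteq> 0" using tr_nonzero by blast
    have "h1 (ract x (star (t * inverse (h1 x z)))) z = t"
      using d by (simp add: h1_left D.star_star mult.assoc)
    then show False using assms[of "ract x (star (t * inverse (h1 x z)))"] t by simp
  qed
  then have "h1 z x = 0" for x using W1.hermitian[of z x] by simp
  then show ?thesis by (intro W1.nondegenerate) simp
qed

text \<open>A family dual to a basis of \<open>V\<close> completes it to a basis of
  \<open>W2\<close>; here the dimension 2m enters. Pairing with \<open>tens x v\<close> then detects
  the component of a vector along \<open>u v\<close>, which gives coisotropy without counting
  dimensions over the base field.\<close>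

lemma split_lagrangian:
  assumes "split_hermitian lact h2"
  obtains V where "subspace (span {tens x v |x v. v \<in> V})"
    "\<And>w w'. w \<in> span {tens x v |x v. v \<in> V} \<Longrightarrow> w' \<in> span {tens x v |x v. v \<in> V} \<Longrightarrow> form w w' = 0"
    "\<And>w. (\<forall>w'\<in>span {tens x v |x v. v \<in> V}. form w' w = 0) \<Longrightarrow> w \<in> span {tens x v |x v. v \<in> V}"
proof -
  obtain m V where dimW: "has_D_dim lact UNIV (2 * m)" and dimV: "has_D_dim lact V m"
    and isoV: "\<And>x y. x \<in> V \<Longrightarrow> y \<in> V \<Longrightarrow> h2 x y = 0"
    using assms unfolding split_hermitian_def by blast
  obtain C where C: "finite C" "card C = 2 * m" "D_span lact C = UNIV"
    using dimW unfolding has_D_dim_def by (elim exE conjE) (rule that)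
  obtain B where B: "finite B" "card B = m" "D_span lact B = V"
    and indepB: "\<forall>c. (\<Sum>b\<in>B. lact (c b) b) = 0 \<longrightarrow> (\<forall>b\<in>B. c b = 0)"
    using dimV unfolding has_D_dim_def by (elim exE conjE) (rule that)
  have BV: "b \<in> V" if "b \<in> B" for b using W2.D_span_base[OF B(1) that] B(3) by simp
  have "\<exists>u. \<forall>i\<in>B. \<forall>j\<in>B. h2 i (u j) = (if i = j then 1 else 0)"
  \<comment> \<open>\<open>h2\<close> is conjugate linear in its second argument, so multiplication
    of values from the right corresponds to the action of \<open>star d\<close>.\<close>
  proof (rule dual_family[where act = lact and ract = "\<lambda>u d. lact (star d) u" and v = "\<lambda>b. b"])
    show "x = 0" if "\<forall>u. h2 x u = 0" for x using that by (rule W2.nondegenerate)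
    show "\<forall>b\<in>B. c b = 0" if "(\<Sum>b\<in>B. lact (c b) b) = 0" for c
      using indepB[THEN spec, THEN mp, OF that] .
  qed (simp_all add: W2.add_left W2.add_right h2_left h2_right D.star_star B(1))
  then obtain u where "\<forall>i\<in>B. \<forall>j\<in>B. h2 i (u j) = (if i = j then 1 else 0)" ..
  then have u: "h2 i (u j) = (if i = j then 1 else 0)" if "i \<in> B" "j \<in> B" for i j using that by simp
  have uB: "h2 (u j) i = (if i = j then eps2 else 0)" if "i \<in> B" "j \<in> B" for i j
    using W2.hermitian[of "u j" i] u[OF that] by simp
  have "Modules.additive (\<lambda>x. h2 x y)" for y by (simp add: Modules.additive.intro W2.add_left)
  then have h2_sum: "h2 (\<Sum>i\<in>I. g i) y = (\<Sum>i\<in>I. h2 (g i) y)" for I :: "'w2 set" and g y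
    using Modules.additive.sum by fastforce
  \<comment> \<open>The boolean index keeps \<open>v\<close> and \<open>u v\<close> apart without
    any claim that the vectors are distinct.\<close>
  define f where "f i = (if snd i then fst i else u (fst i))" for i
  have fsum: "(\<Sum>i\<in>B \<times> UNIV. lact (c i) (f i)) =
      (\<Sum>b\<in>B. lact (c (b, True)) b) + (\<Sum>b\<in>B. lact (c (b, False)) (u b))" for c
    by (simp add: sum.cartesian_product' UNIV_bool f_def sum.distrib add.commute)
  have spans: "\<exists>a b. y = (\<Sum>v\<in>B. lact (a v) v) + (\<Sum>v\<in>B. lact (b v) (u v))" for y
  proof -
    have "\<forall>i\<in>B \<times> UNIV. c i = 0" if c: "(\<Sum>i\<in>B \<times> UNIV. lact (c i) (f i)) = 0" for c
    proof -
      \<comment> \<open>Pairing with \<open>v\<close> annihilates the terms in \<open>V\<close> and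
        isolates the coefficient of \<open>u v\<close>.\<close>
      have F: "c (v, False) = 0" if v: "v \<in> B" for v
      proof -
        have "0 = h2 ((\<Sum>b\<in>B. lact (c (b, True)) b) + (\<Sum>b\<in>B. lact (c (b, False)) (u b))) v"
          using c h2_left[of 0 0 v] unfolding fsum by simp
        also have "\<dots> = (\<Sum>b\<in>B. c (b, True) * h2 b v) + (\<Sum>b\<in>B. c (b, False) * h2 (u b) v)"
          by (simp add: W2.add_left h2_sum h2_left)
        also have "(\<Sum>b\<in>B. c (b, True) * h2 b v) = 0"
          using isoV BV v by (intro sum.neutral) auto
        also have "(\<Sum>b\<in>B. c (b, False) * h2 (u b) v) = (\<Sum>b\<in>B. if b = v then c (b, False) * eps2 else 0)"
          by (rule sum.cong) (use uB[OF v] in auto)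
        finally show ?thesis using v B(1) by simp
      qed
      then have "(\<Sum>b\<in>B. lact (c (b, True)) b) = 0" using c unfolding fsum by simp
      from indepB[rule_format, OF this] F show ?thesis by (auto simp: all_bool_eq)
    qed
    then obtain c where "y = (\<Sum>i\<in>B \<times> UNIV. lact (c i) (f i))"
      using W2.independent_family_spans[OF C(1,3), of "B \<times> (UNIV :: bool set)" f y] B(1,2) C(2)
      by (auto simp: card_cartesian_product)
    then show ?thesis unfolding fsum
      by (intro exI[of _ "\<lambda>v. c (v, True)"] exI[of _ "\<lambda>v. c (v, False)"])
  qed
  let ?G = "{tens x v |x v. v \<in> V}"
  have iso: "form w w' = 0" if w: "w \<in> span ?G" "w' \<in> span ?G" for w w'
    by (rule span_isotropic[OF _ w]) (auto simp: form_tens isoV)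
  \<comment> \<open>Scalars act through the first factor, so these sums, with only the
    \<open>u\<close> part kept in normal form, are a subspace; it contains all pure tensors.\<close>
  define Z where "Z = {\<xi> + (\<Sum>v\<in>B. tens (z v) (u v)) |\<xi> z. \<xi> \<in> span ?G}"
  have ZI: "\<xi> + (\<Sum>v\<in>B. tens (z v) (u v)) \<in> Z" if "\<xi> \<in> span ?G" for \<xi> z
    unfolding Z_def by (rule CollectI, intro exI[of _ \<xi>] exI[of _ z] conjI refl that)
  have "subspace Z"
    unfolding subspace_def
  proof (intro conjI ballI allI)
    show "0 \<in> Z" using ZI[OF span_zero, of "\<lambda>_. 0"] by simp
  next
    fix w w' assume "w \<in> Z" "w' \<in> Z"
    then obtain \<xi> z \<xi>' z' where w: "\<xi> \<in> span ?G" "\<xi>' \<in> span ?G"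
        "w = \<xi> + (\<Sum>v\<in>B. tens (z v) (u v))" "w' = \<xi>' + (\<Sum>v\<in>B. tens (z' v) (u v))"
      unfolding Z_def by blast
    then have eq: "w + w' = (\<xi> + \<xi>') + (\<Sum>v\<in>B. tens (z v + z' v) (u v))"
      by (simp add: tens_add_left sum.distrib)
    show "w + w' \<in> Z" unfolding eq by (rule ZI[OF span_add[OF w(1,2)]])
  next
    fix a w assume "w \<in> Z"
    then obtain \<xi> z where w: "\<xi> \<in> span ?G" "w = \<xi> + (\<Sum>v\<in>B. tens (z v) (u v))"
      unfolding Z_def by blast
    then have eq: "smul a w = smul a \<xi> + (\<Sum>v\<in>B. tens (ract (z v) (smulD a 1)) (u v))"
      by (simp add: scale_right_distrib scale_sum_right tens_scale)
    show "smul a w \<in> Z" unfolding eq by (rule ZI[OF span_scale[OF w(1)]])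
  qed
  moreover have "tens x y \<in> Z" for x y
  proof -
    obtain a b where y: "y = (\<Sum>v\<in>B. lact (a v) v) + (\<Sum>v\<in>B. lact (b v) (u v))" using spans by blast
    have "tens x y = (\<Sum>v\<in>B. tens (ract x (a v)) v) + (\<Sum>v\<in>B. tens (ract x (b v)) (u v))"
      by (simp add: y tens_add_right tens_sum_right tens_balanced)
    moreover have "(\<Sum>v\<in>B. tens (ract x (a v)) v) \<in> span ?G"
      by (intro span_sum span_base) (use BV in blast)
    ultimately show ?thesis by (simp only: ZI)
  qed
  then have "{tens x y |x y. True} \<subseteq> Z" by blast
  ultimately have Z: "w \<in> Z" for w using span_minimal tens_span[of w] by blast
  have "w \<in> span ?G" if w: "\<forall>w'\<in>span ?G. form w' w = 0" for w
  proof -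
    obtain \<xi> z where xi: "\<xi> \<in> span ?G" "w = \<xi> + (\<Sum>v\<in>B. tens (z v) (u v))"
      using Z[of w] unfolding Z_def by blast
    have "z v = 0" if v: "v \<in> B" for v
    proof (rule h1_trace_nondegenerate)
      fix x
      have xv: "tens x v \<in> span ?G" by (rule span_base) (use BV[OF v] in blast)
      have "0 = form (tens x v) w" using w xv by simp
      also have "\<dots> = (\<Sum>b\<in>B. tr (h1 x (z b) * star (h2 v (u b))))"
        by (simp add: xi(2) form_add_right form_sum_right iso[OF xv xi(1)] form_tens)
      also have "\<dots> = (\<Sum>b\<in>B. if b = v then tr (h1 x (z b)) else 0)"
        by (rule sum.cong) (use u[OF v] in auto)
      finally show "tr (h1 x (z v)) = 0" using v B(1) by simp
    qed
    then show ?thesis using xi by simp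
  qed
  then show thesis using that[of V] iso subspace_span by blast
qed

end

theorem proposition4p2:
  fixes absF :: "'f::field \<Rightarrow> real" and p :: nat
    and smul :: "'f \<Rightarrow> 'w::ab_group_add \<Rightarrow> 'w" and form :: "'w \<Rightarrow> 'w \<Rightarrow> 'f"
    and \<psi> :: "'f \<Rightarrow> 'r::field"
    and smulS :: "'r \<Rightarrow> 's::ab_group_add \<Rightarrow> 's" and \<rho> :: "'w \<times> 'f \<Rightarrow> 's \<Rightarrow> 's"
    and H1 H2 :: "('w \<Rightarrow> 'w) set"
  assumes "nonarch_local_field absF p" and "CHAR('f) \<noteq> 2"
    and "symplectic_space smul form"
    and "CHAR('r) \<noteq> 2"
    and "smooth_character absF \<psi>" and "\<exists>x. \<psi> x \<noteq> 1"
    and "heisenberg_rep smulS absF smul form \<psi> \<rho>"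
    and "irreducible_dual_pair smul form H1 H2"
  shows "(type_II_pair TYPE('d::division_ring \<times> 'x1::ab_group_add \<times> 'x2::ab_group_add) smul form H1 H2
           \<longrightarrow> Mp_split smul form smulS \<rho> H1 \<and> Mp_split smul form smulS \<rho> H2)
       \<and> (type_I_pair TYPE('e::division_ring \<times> 'w1::ab_group_add \<times> 'w2::ab_group_add) smul form H1 H2
           \<longrightarrow> (\<exists>(smulD :: 'f \<Rightarrow> 'e \<Rightarrow> 'e) star (ract :: 'w1 \<Rightarrow> 'e \<Rightarrow> 'w1) eps1 h1
                  (lact :: 'e \<Rightarrow> 'w2 \<Rightarrow> 'w2) eps2 h2 tr tens.
                  realizes_type_I smul form H1 H2 smulD star ract eps1 h1 lact eps2 h2 tr tens)
             \<and> (\<forall>(smulD :: 'f \<Rightarrow> 'e \<Rightarrow> 'e) star (ract :: 'w1 \<Rightarrow> 'e \<Rightarrow> 'w1) eps1 h1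
                  (lact :: 'e \<Rightarrow> 'w2 \<Rightarrow> 'w2) eps2 h2 tr tens.
                  realizes_type_I smul form H1 H2 smulD star ract eps1 h1 lact eps2 h2 tr tens \<and>
                  split_hermitian lact h2
                  \<longrightarrow> Mp_split smul form smulS \<rho> H1))"
proof -
  note split = Mp_split_lagrangian_stabilizer[OF assms(1-3,5-7)]
  have II: "Mp_split smul form smulS \<rho> H1 \<and> Mp_split smul form smulS \<rho> H2"
    if pair: "type_II_pair TYPE('d \<times> 'x1 \<times> 'x2) smul form H1 H2"
  proof -
    obtain smulD :: "'f \<Rightarrow> 'd \<Rightarrow> 'd" and ract :: "'x1 \<Rightarrow> 'd \<Rightarrow> 'x1" and lact :: "'d \<Rightarrow> 'x2 \<Rightarrow> 'x2"
      and tens X Y where dec: "type_II_decomposition smul form smulD ract lact tens X Y"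
      and H: "H1 = type_II_GL1 smul form ract tens X Y" "H2 = type_II_GL2 smul form lact tens X Y"
      using pair unfolding type_II_pair_def by blast
    interpret type_II_decomposition smul form smulD ract lact tens X Y by (rule dec)
    \<comment> \<open>The component of \<open>w\<close> in \<open>Y\<close> is orthogonal to
      \<open>X\<close>, because \<open>X\<close> is isotropic, and to \<open>Y\<close>, because
      \<open>Y\<close> is; so it is 0.\<close>
    have coiso: "w \<in> X" if w: "\<forall>x\<in>X. form x w = 0" for w
    proof -
      obtain x y where xy: "x \<in> X" "y \<in> Y" "w = x + y" using direct_sum(2) by blast
      have "form y w' = 0" for w'
      proof -
        obtain x' y' where xy': "x' \<in> X" "y' \<in> Y" "w' = x' + y'" using direct_sum(2) by blast
        have "form x' (x + y) = 0" using w xy'(1) xy(3) by simp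
        then have "form x' y = 0" using isotropic_X[OF xy'(1) xy(1)] by (simp add: form_add_right)
        then have "form y x' = 0" using form_swap[of y x'] by simp
        then show ?thesis using isotropic_Y[OF xy(2) xy'(2)] by (simp add: xy'(3) form_add_right)
      qed
      then have "y = 0" by (intro form_nondegenerate) simp
      then show ?thesis using xy by simp
    qed
    show ?thesis
      by (intro conjI split[OF subspace_X isotropic_X coiso])
        (auto simp: H type_II_GL1_def type_II_GL2_def)
  qed
  have I: "Mp_split smul form smulS \<rho> H1"
    if real: "realizes_type_I smul form H1 H2 smulD star ract eps1 h1 lact eps2 h2 tr tens"
      and sp: "split_hermitian lact h2"
    for smulD :: "'f \<Rightarrow> 'e \<Rightarrow> 'e" and star and ract :: "'w1 \<Rightarrow> 'e \<Rightarrow> 'w1" and eps1 h1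
      and lact :: "'e \<Rightarrow> 'w2 \<Rightarrow> 'w2" and eps2 h2 tr tens
  proof -
    interpret type_I_decomposition smul form smulD star ract eps1 h1 lact eps2 h2 tr tens
      using real unfolding realizes_type_I_def by blast
    have H: "H1 = type_I_U1 smul form ract h1 tens" using real unfolding realizes_type_I_def by blast
    obtain V where V: "subspace (span {tens x v |x v. v \<in> V})"
      "\<And>w w'. w \<in> span {tens x v |x v. v \<in> V} \<Longrightarrow> w' \<in> span {tens x v |x v. v \<in> V} \<Longrightarrow> form w w' = 0"
      "\<And>w. (\<forall>w'\<in>span {tens x v |x v. v \<in> V}. form w' w = 0) \<Longrightarrow> w \<in> span {tens x v |x v. v \<in> V}"
      by (rule split_lagrangian[OF sp], rule that)
    show ?thesis
    proof (rule split[OF V])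
      show "H1 \<subseteq> carrier (Sp smul form)" by (auto simp: H type_I_U1_def)
      fix h w assume h: "h \<in> H1" and w: "w \<in> span {tens x v |x v. v \<in> V}"
      then obtain g where g: "\<And>x y. h (tens x y) = tens (g x) y" by (auto simp: H type_I_U1_def)
      interpret h: Vector_Spaces.linear smul smul h using h by (auto simp: H type_I_U1_def Sp_def)
      \<comment> \<open>\<open>h\<close> changes only the first tensor factor and leaves
        \<open>v\<close> in \<open>V\<close> untouched.\<close>
      have "h ` {tens x v |x v. v \<in> V} \<subseteq> {tens x v |x v. v \<in> V}" using g by blast
      then have "span (h ` {tens x v |x v. v \<in> V}) \<subseteq> span {tens x v |x v. v \<in> V}" by (rule span_mono)
      then show "h w \<in> span {tens x v |x v. v \<in> V}"
        using w h.span_image[of "{tens x v |x v. v \<in> V}"] by blast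
    qed
  qed
  show ?thesis using II I unfolding type_I_pair_def by blast
qed

end
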